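(* Let $H$ be a Hilbert $\mathfrak{A}$-module over a $C^*$-algebra $\mathfrak{A}$. Let $T,A,S\in\mathcal{L}(H)$ have the polar decompositions $T=U_T|T|$, $A=U_A|A|$ and $S=U_S|S|$, respectively. Suppose that $\big[|T|,A\big]=0$. Let $X=TAS$, $Y=|T|\cdot A\cdot|S^*|$ and $W=U_T^*U_TU_AU_SU_S^*$. Then the following statements are equivalent: (i) $X=U_TU_AU_S|X|$ is the polar decomposition; (ii) $Y=W|Y|$ is the polar decomposition; (iii) $X=U_TU_AU_S|X|$; (iv) $Y=W|Y|$; (v) $|T|\cdot|A|\cdot|S^*|$ is positive.
   Context: $\mathcal{L}(H)$ denotes the $C^*$-algebra of adjointable operators on $H$; $\mathcal{R}(\cdot)$ denotes range; $[B,C]=BC-CB$ is the commutator; "positive" means positive as an element of $\mathcal{L}(H)$. For an adjointable operator $B$, $|B|=(B^*B)^{1/2}$. A closed submodule $M$ of $H$ is orthogonally complemented if $H=M\dotplus M^\perp$, and then $P_M$ is the projection of $H$ onto $M$. An operator $U\in\mathcal{L}(H)$ is a partial isometry if $U^*U$ is a projection. Polar decomposition: for $B\in\mathcal{L}(H)$, "$B=U|B|$ is the polar decomposition" (or "$B$ has the polar decomposition $B=U|B|$") means that $U\in\mathcal{L}(H)$ is a partial isometry such that $B=U|B|$ and $U^*U=P_{\overline{\mathcal{R}(B^* )}}$ (in particular $\overline{\mathcal{R}(B^* )}$ is orthogonally complemented). Such a $U$ is unique if it exists, but it need not exist in general. Statements (iii) and (iv) assert only the displayed operator identities. *)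

theory Defs
  imports "HOL-Analysis.Analysis"
begin

section \<open>C*-algebras\<close>

class complex_vector = real_vector +
  fixes scaleC :: "complex \<Rightarrow> 'a \<Rightarrow> 'a"  (infixr \<open>*\<^sub>C\<close> 75)
  assumes scaleC_add_right: "c *\<^sub>C (x + y) = c *\<^sub>C x + c *\<^sub>C y"
    and scaleC_add_left: "(c + d) *\<^sub>C x = c *\<^sub>C x + d *\<^sub>C x"
    and scaleC_scaleC: "c *\<^sub>C d *\<^sub>C x = (c * d) *\<^sub>C x"
    and scaleC_of_real: "complex_of_real r *\<^sub>C x = r *\<^sub>R x"

text \<open>No unit is required.\<close>

class cstar_algebra = complex_vector + real_normed_algebra + banach +
  fixes cstar :: "'a \<Rightarrow> 'a"
  assumes scaleC_mult_left: "(c *\<^sub>C a) * b = c *\<^sub>C (a * b)"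
    and scaleC_mult_right: "a * (c *\<^sub>C b) = c *\<^sub>C (a * b)"
    and norm_scaleC: "norm (c *\<^sub>C a) = cmod c * norm a"
    and cstar_cstar: "cstar (cstar a) = a"
    and cstar_add: "cstar (a + b) = cstar a + cstar b"
    and cstar_scaleC: "cstar (c *\<^sub>C a) = cnj c *\<^sub>C cstar a"
    and cstar_mult: "cstar (a * b) = cstar b * cstar a"
    and cstar_norm: "norm (cstar a * a) = (norm a)\<^sup>2"

text \<open>
  The pair \<open>(a, \<alpha>)\<close> stands for \<open>a + \<alpha> 1\<close> in the unitization. The spectrum below is the
  one in the unitization; if the algebra already has a unit, it differs from the
  spectrum in the algebra itself at most by the point 0, which is irrelevant for positivity.
\<close>

definition unitization_mult ::
  "'a::cstar_algebra \<times> complex \<Rightarrow> 'a \<times> complex \<Rightarrow> 'a \<times> complex" where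
  "unitization_mult p q =
     (fst p * fst q + snd p *\<^sub>C fst q + snd q *\<^sub>C fst p, snd p * snd q)"

definition cstar_spectrum :: "'a::cstar_algebra \<Rightarrow> complex set" where
  "cstar_spectrum a = {\<mu>. \<not> (\<exists>q. unitization_mult (- a, \<mu>) q = (0, 1) \<and>
                                   unitization_mult q (- a, \<mu>) = (0, 1))}"

definition cstar_positive :: "'a::cstar_algebra \<Rightarrow> bool" where
  "cstar_positive a \<longleftrightarrow> cstar a = a \<and> cstar_spectrum a \<subseteq> \<real>\<^sub>\<ge>\<^sub>0"


section \<open>Hilbert C*-modules\<close>

text \<open>
  Right modules, with inner product linear in the second variable. The norm (and with
  it the topology) of the type \<open>'h\<close> is the one induced by the inner product, and
  completeness is part of the class \<open>banach\<close>.
\<close>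

locale hilbert_module =
  fixes act :: "'h::{complex_vector, banach} \<Rightarrow> 'a::cstar_algebra \<Rightarrow> 'h"
    and ip :: "'h \<Rightarrow> 'h \<Rightarrow> 'a"
  assumes act_add_left: "act (x + y) a = act x a + act y a"
    and act_add_right: "act x (a + b) = act x a + act x b"
    and act_mult: "act x (a * b) = act (act x a) b"
    and act_scaleC_left: "act (c *\<^sub>C x) a = c *\<^sub>C act x a"
    and act_scaleC_right: "act x (c *\<^sub>C a) = c *\<^sub>C act x a"
    and ip_add_right: "ip x (y + z) = ip x y + ip x z"
    and ip_scaleC_right: "ip x (c *\<^sub>C y) = c *\<^sub>C ip x y"
    and ip_act_right: "ip x (act y a) = ip x y * a"
    and ip_cstar: "cstar (ip x y) = ip y x"
    and ip_positive: "cstar_positive (ip x x)"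
    and ip_definite: "ip x x = 0 \<Longrightarrow> x = 0"
    and norm_eq_sqrt_ip: "norm x = sqrt (norm (ip x x))"

definition orth_compl :: "('h \<Rightarrow> 'h \<Rightarrow> 'a::zero) \<Rightarrow> 'h set \<Rightarrow> 'h set" where
  "orth_compl ip M = {x. \<forall>y\<in>M. ip x y = 0}"

definition closed_submodule ::
  "('h::{complex_vector, banach} \<Rightarrow> 'a \<Rightarrow> 'h) \<Rightarrow> 'h set \<Rightarrow> bool" where
  "closed_submodule act M \<longleftrightarrow> closed M \<and> 0 \<in> M \<and> (\<forall>x\<in>M. \<forall>y\<in>M. x + y \<in> M) \<and>
     (\<forall>c. \<forall>x\<in>M. c *\<^sub>C x \<in> M) \<and> (\<forall>x\<in>M. \<forall>a. act x a \<in> M)"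

definition orth_complemented ::
  "('h::{complex_vector, banach} \<Rightarrow> 'a::zero \<Rightarrow> 'h) \<Rightarrow> ('h \<Rightarrow> 'h \<Rightarrow> 'a) \<Rightarrow> 'h set \<Rightarrow> bool" where
  "orth_complemented act ip M \<longleftrightarrow> closed_submodule act M \<and> M \<inter> orth_compl ip M = {0} \<and>
     (\<forall>x. \<exists>m\<in>M. \<exists>n\<in>orth_compl ip M. x = m + n)"

definition proj_onto :: "('h::ab_group_add \<Rightarrow> 'h \<Rightarrow> 'a::zero) \<Rightarrow> 'h set \<Rightarrow> 'h \<Rightarrow> 'h" where
  "proj_onto ip M = (\<lambda>x. THE m. m \<in> M \<and> x - m \<in> orth_compl ip M)"


section \<open>Adjointable operators\<close>

text \<open>Linearity and boundedness of adjointable maps are consequences of the definition.\<close>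

definition adjointable :: "('h \<Rightarrow> 'h \<Rightarrow> 'a) \<Rightarrow> ('h \<Rightarrow> 'h) \<Rightarrow> bool" where
  "adjointable ip B \<longleftrightarrow> (\<exists>C. \<forall>x y. ip (B x) y = ip x (C y))"

definition adj :: "('h \<Rightarrow> 'h \<Rightarrow> 'a) \<Rightarrow> ('h \<Rightarrow> 'h) \<Rightarrow> 'h \<Rightarrow> 'h" where
  "adj ip B = (THE C. \<forall>x y. ip (B x) y = ip x (C y))"

definition op_spectrum ::
  "('h::complex_vector \<Rightarrow> 'h \<Rightarrow> 'a) \<Rightarrow> ('h \<Rightarrow> 'h) \<Rightarrow> complex set" where
  "op_spectrum ip B = {\<mu>. \<not> (\<exists>R. adjointable ip R \<and>
     R \<circ> (\<lambda>x. \<mu> *\<^sub>C x - B x) = id \<and> (\<lambda>x. \<mu> *\<^sub>C x - B x) \<circ> R = id)}"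

definition op_positive :: "('h::complex_vector \<Rightarrow> 'h \<Rightarrow> 'a) \<Rightarrow> ('h \<Rightarrow> 'h) \<Rightarrow> bool" where
  "op_positive ip B \<longleftrightarrow> adjointable ip B \<and> adj ip B = B \<and> op_spectrum ip B \<subseteq> \<real>\<^sub>\<ge>\<^sub>0"

definition op_sqrt :: "('h::complex_vector \<Rightarrow> 'h \<Rightarrow> 'a) \<Rightarrow> ('h \<Rightarrow> 'h) \<Rightarrow> 'h \<Rightarrow> 'h" where
  "op_sqrt ip B = (THE C. op_positive ip C \<and> C \<circ> C = B)"

definition op_abs :: "('h::complex_vector \<Rightarrow> 'h \<Rightarrow> 'a) \<Rightarrow> ('h \<Rightarrow> 'h) \<Rightarrow> 'h \<Rightarrow> 'h" where
  "op_abs ip B = op_sqrt ip (adj ip B \<circ> B)"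

definition commutator :: "('h::ab_group_add \<Rightarrow> 'h) \<Rightarrow> ('h \<Rightarrow> 'h) \<Rightarrow> 'h \<Rightarrow> 'h" where
  "commutator B C = (\<lambda>x. B (C x) - C (B x))"

definition is_projection :: "('h \<Rightarrow> 'h \<Rightarrow> 'a) \<Rightarrow> ('h \<Rightarrow> 'h) \<Rightarrow> bool" where
  "is_projection ip P \<longleftrightarrow> adjointable ip P \<and> P \<circ> P = P \<and> adj ip P = P"

definition partial_isometry :: "('h \<Rightarrow> 'h \<Rightarrow> 'a) \<Rightarrow> ('h \<Rightarrow> 'h) \<Rightarrow> bool" where
  "partial_isometry ip U \<longleftrightarrow> adjointable ip U \<and> is_projection ip (adj ip U \<circ> U)"

text \<open>\<open>polar_decomposition act ip B U\<close>: \<open>B = U |B|\<close> is the polar decomposition of \<open>B\<close>.\<close>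

definition polar_decomposition ::
  "('h::{complex_vector, banach} \<Rightarrow> 'a::zero \<Rightarrow> 'h) \<Rightarrow> ('h \<Rightarrow> 'h \<Rightarrow> 'a) \<Rightarrow>
   ('h \<Rightarrow> 'h) \<Rightarrow> ('h \<Rightarrow> 'h) \<Rightarrow> bool" where
  "polar_decomposition act ip B U \<longleftrightarrow>
     partial_isometry ip U \<and> B = U \<circ> op_abs ip B \<and>
     orth_complemented act ip (closure (range (adj ip B))) \<and>
     adj ip U \<circ> U = proj_onto ip (closure (range (adj ip B)))"

end

theory Submission
  imports Defs
begin

text \<open>
  Write \<open>Z = |T| |A| |S\<^sup>*|\<close>, \<open>P\<^sub>T = U\<^sub>T\<^sup>* U\<^sub>T\<close>, \<open>P\<^sub>A = U\<^sub>A\<^sup>* U\<^sub>A\<close>, \<open>Q = U\<^sub>S U\<^sub>S\<^sup>*\<close> and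
  \<open>E = P\<^sub>T P\<^sub>A\<close>. Since \<open>|T|\<close> commutes with \<open>A\<close>, it commutes with \<open>A\<^sup>*\<close>, with \<open>|A|\<close> (a limit of
  polynomials in \<open>A\<^sup>* A\<close>) and, by density of the range of \<open>|A|\<close>, with \<open>U\<^sub>A\<close>; passing to the range
  projection, so does \<open>P\<^sub>T\<close>. Hence \<open>E\<close> is a projection, \<open>Y = U\<^sub>A Z\<close>, \<open>Z = U\<^sub>A\<^sup>* Y\<close> and
  \<open>Z\<^sup>* Z = Y\<^sup>* Y\<close>.

  All four statements about polar decompositions are then compared with the positivity of \<open>Z\<close>.
  If \<open>Z\<close> is positive, it is its own absolute value, so \<open>Z = |Y|\<close> and \<open>Y = U\<^sub>A |Y| = W |Y|\<close>.
  Conversely \<open>Y = W |Y|\<close> gives \<open>Z = E |Y|\<close>, and \<open>|Y| E |Y| = Z\<^sup>* Z = |Y| |Y|\<close> forces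
  \<open>E |Y| = |Y|\<close>, so that \<open>Z = |Y|\<close> is positive (\<open>Y_eq_iff_pos\<close>). Because \<open>X = U\<^sub>T Y U\<^sub>S\<close> and
  \<open>|X| = U\<^sub>S\<^sup>* |Y| U\<^sub>S\<close>, the identity for \<open>X\<close> is the one for \<open>Y\<close> multiplied by \<open>U\<^sub>T\<close> and \<open>U\<^sub>S\<close>
  (\<open>X_eq_iff_Y_eq\<close>). What remains is that the displayed identities already are polar
  decompositions. If \<open>Z\<close> is positive, the self-adjoint operators \<open>|T| |A|\<close> and \<open>|S\<^sup>*|\<close> have a
  self-adjoint product, hence commute; their range projections \<open>E\<close> and \<open>Q\<close> then commute as well and
  \<open>QE\<close> is the range projection of \<open>Z\<close>. It equals \<open>W\<^sup>* W\<close>, and transporting it along \<open>U\<^sub>S\<close> gives the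
  initial projection of \<open>U\<^sub>T U\<^sub>A U\<^sub>S\<close> (\<open>polar_Y\<close>, \<open>polar_X\<close>).

  The operator theory needed for this is developed with a norm criterion for positivity:
  \<open>a\<close> is positive iff it is self-adjoint and \<open>\<parallel>t - a\<parallel> \<le> t\<close> for some \<open>t \<ge> 0\<close>. With this criterion
  sums of positive elements are positive at once, and square roots come from an iteration
  by polynomials, which also shows what they commute with. The trigonometric identity
  \<open>cos\<^sup>2 + sin\<^sup>2 = 1\<close>, read as the construction of a unitary, replaces the spectral radius formula.
  The criterion is equivalent to the spectral definition (\<open>op_positive_iff_pos\<close>), so absolute
  values exist and are unique.

  These arguments use of the module only the C*-identity for its operators, which rests on the
  Cauchy-Schwarz inequality. The latter is obvious for a C*-algebra as a module over itself. So the
  theory is applied twice: first to left multiplications on the coefficient algebra, where it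
  supplies the order properties from which the Cauchy-Schwarz inequality of an arbitrary Hilbert
  module follows, and then to the adjointable operators on that module.
\<close>

section \<open>Positive elements of an algebra of operators\<close>

text \<open>
  Turns an equation between products into a rewrite rule that also applies inside
  right-nested products.
\<close>

lemma mult_left_cong:
  fixes a b c z :: "'a::semigroup_mult"
  shows "a * b = c \<Longrightarrow> a * (b * z) = c * z"
  by (simp flip: mult.assoc)

text \<open>
  A real Banach algebra carrying a C*-structure on a closed subalgebra \<open>A\<close>. Complex scalars enter only
  through multiplication by the imaginary unit, which is the central element \<open>J\<close>. The intended \<open>A\<close> is
  the set of adjointable operators inside the algebra of all bounded ones; the unit may have norm
  0, because the module may be trivial.
\<close>

locale star_algebra =
  fixes A :: "'b::{real_normed_algebra, monoid_mult, banach} set"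
    and star :: "'b \<Rightarrow> 'b" and J :: 'b
  assumes one_mem: "1 \<in> A"
    and add_mem: "a \<in> A \<Longrightarrow> b \<in> A \<Longrightarrow> a + b \<in> A"
    and mult_mem: "a \<in> A \<Longrightarrow> b \<in> A \<Longrightarrow> a * b \<in> A"
    and scaleR_mem: "a \<in> A \<Longrightarrow> r *\<^sub>R a \<in> A"
    and star_mem: "a \<in> A \<Longrightarrow> star a \<in> A"
    and closed_carrier: "closed A"
    and star_star: "a \<in> A \<Longrightarrow> star (star a) = a"
    and star_add: "a \<in> A \<Longrightarrow> b \<in> A \<Longrightarrow> star (a + b) = star a + star b"
    and star_scaleR: "a \<in> A \<Longrightarrow> star (r *\<^sub>R a) = r *\<^sub>R star a"
    and star_mult: "a \<in> A \<Longrightarrow> b \<in> A \<Longrightarrow> star (a * b) = star b * star a"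
    and cstar_identity: "a \<in> A \<Longrightarrow> norm (star a * a) = (norm a)\<^sup>2"
    and J_mem: "J \<in> A"
    and J_J: "J * J = - 1"
    and J_central: "a \<in> A \<Longrightarrow> J * a = a * J"
    and star_J: "star J = - J"
begin

lemma zero_mem: "0 \<in> A"
  using scaleR_mem[OF one_mem, of 0] by simp

lemma minus_mem: "a \<in> A \<Longrightarrow> - a \<in> A"
  using scaleR_mem[of a "-1"] by simp

lemma diff_mem: "a \<in> A \<Longrightarrow> b \<in> A \<Longrightarrow> a - b \<in> A"
  using add_mem[OF _ minus_mem, of a b] by simp

lemmas mem = one_mem zero_mem add_mem mult_mem scaleR_mem star_mem minus_mem diff_mem J_mem

lemma star_minus: "a \<in> A \<Longrightarrow> star (- a) = - star a"
  using star_scaleR[of a "-1"] by simp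

lemma star_diff: "a \<in> A \<Longrightarrow> b \<in> A \<Longrightarrow> star (a - b) = star a - star b"
  using star_add[OF _ minus_mem, of a b] star_minus[of b] by simp

lemma star_one: "star 1 = 1"
  using star_mult[OF star_mem[OF one_mem] one_mem] star_star[OF one_mem] by simp

lemma star_zero: "star 0 = 0"
  using star_scaleR[OF one_mem, of 0] by simp

lemmas star_rules = star_star star_add star_scaleR star_mult star_J star_minus star_diff star_one star_zero

lemma norm_star: assumes "a \<in> A" shows "norm (star a) = norm a"
proof -
  have le: "norm b \<le> norm (star b)" if "b \<in> A" for b
  proof (cases "b = 0")
    case False
    have "norm b * norm b \<le> norm (star b) * norm b"
      using cstar_identity[OF that] norm_mult_ineq[of "star b" b] by (simp add: power2_eq_square)
    then show ?thesis using False by simp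
  qed (simp add: star_zero)
  show ?thesis using le[OF assms] le[OF star_mem[OF assms]] star_star[OF assms] by simp
qed

lemma norm_one_le: "norm (1::'b) \<le> 1"
proof -
  have "norm (1::'b) = norm (1::'b) ^ 2" using cstar_identity[OF one_mem] star_one by simp
  then have "norm (1::'b) = 0 \<or> norm (1::'b) = 1" by (simp add: power2_eq_square)
  then show ?thesis by auto
qed

lemma norm_scaleR_one_le: "0 \<le> r \<Longrightarrow> norm (r *\<^sub>R (1::'b)) \<le> r"
  using mult_left_mono[OF norm_one_le, of r] by simp

definition selfadj :: "'b \<Rightarrow> bool" where
  "selfadj a \<longleftrightarrow> a \<in> A \<and> star a = a"

lemma selfadj_mem: "selfadj a \<Longrightarrow> a \<in> A" by (simp add: selfadj_def)
lemma selfadj_star: "selfadj a \<Longrightarrow> star a = a" by (simp add: selfadj_def)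
lemma selfadj_one: "selfadj 1" by (simp add: selfadj_def mem star_rules)
lemma selfadj_zero: "selfadj 0" by (simp add: selfadj_def mem star_rules)
lemma selfadj_add: "selfadj a \<Longrightarrow> selfadj b \<Longrightarrow> selfadj (a + b)" by (simp add: selfadj_def mem star_rules)
lemma selfadj_diff: "selfadj a \<Longrightarrow> selfadj b \<Longrightarrow> selfadj (a - b)" by (simp add: selfadj_def mem star_rules)
lemma selfadj_minus: "selfadj a \<Longrightarrow> selfadj (- a)" by (simp add: selfadj_def mem star_rules)
lemma selfadj_scaleR: "selfadj a \<Longrightarrow> selfadj (r *\<^sub>R a)" by (simp add: selfadj_def mem star_rules)
lemma selfadj_mult: "selfadj a \<Longrightarrow> selfadj b \<Longrightarrow> a * b = b * a \<Longrightarrow> selfadj (a * b)"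
  by (simp add: selfadj_def mem star_rules)
lemma selfadj_square: "selfadj a \<Longrightarrow> selfadj (a * a)" by (simp add: selfadj_mult)
lemma selfadj_star_mult: "c \<in> A \<Longrightarrow> selfadj (star c * c)"
  by (simp add: selfadj_def mem star_rules)

lemmas selfadj_rules = selfadj_one selfadj_zero selfadj_add selfadj_diff selfadj_minus
  selfadj_scaleR selfadj_square

lemma norm_selfadj_square: "selfadj a \<Longrightarrow> norm (a * a) = (norm a)\<^sup>2"
  using cstar_identity[of a] by (simp add: selfadj_def)

lemma selfadj_square_eq_0: "selfadj a \<Longrightarrow> a * a = 0 \<Longrightarrow> a = 0"
  using norm_selfadj_square[of a] by simp

lemma star_mult_self_eq_0: "c \<in> A \<Longrightarrow> star c * c = 0 \<Longrightarrow> c = 0"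
  using cstar_identity[of c] by simp

lemma closed_selfadj: "closed {a. selfadj a}"
proof -
  have "selfadj l" if lim: "X \<longlonglongrightarrow> l" and X: "\<And>n. selfadj (X n)" for X l
  proof -
    have l: "l \<in> A"
      using closed_sequentially[OF closed_carrier _ lim] X selfadj_mem by blast
    have "norm (star l - X n) = norm (l - X n)" for n
      using norm_star[OF diff_mem[OF l selfadj_mem[OF X]], of n] l X selfadj_mem[OF X]
      by (simp add: star_diff selfadj_star[OF X])
    moreover have "(\<lambda>n. norm (l - X n)) \<longlonglongrightarrow> norm (l - l)"
      by (intro tendsto_intros lim)
    moreover have "(\<lambda>n. norm (star l - X n)) \<longlonglongrightarrow> norm (star l - l)"
      by (intro tendsto_intros lim)
    ultimately have "norm (star l - l) = norm (l - l)"
      using LIMSEQ_unique[of "\<lambda>n. norm (l - X n)" "norm (l - l)" "norm (star l - l)"] by simp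
    then show ?thesis using l by (simp add: selfadj_def)
  qed
  then show ?thesis by (auto simp: closed_sequential_limits)
qed

text \<open>
  With \<open>d = 1 - y\<close> the equation \<open>d\<^sup>2 = 1 - x\<close> becomes the fixed point equation \<open>y = (x + y\<^sup>2) / 2\<close>. The
  iterates from 0 are majorised in norm, together with their increments, by the same iteration on the
  real line at \<open>x = 1\<close>, which is increasing and bounded by 1. Every iterate is a polynomial in \<open>x\<close>, so
  self-adjointness and commutation pass to the limit.
\<close>

lemma sqrt_one_minus:
  assumes x: "selfadj x" and nx: "norm x \<le> 1"
  shows "\<exists>d. selfadj d \<and> norm (1 - d) \<le> 1 \<and> d * d = 1 - x \<and> (\<forall>y. y * x = x * y \<longrightarrow> y * d = d * y)"
proof -
  define f where "f = (\<lambda>y. (1/2) *\<^sub>R (x + y * y))"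
  define Y where "Y n = (f ^^ n) 0" for n
  define g where "g = (\<lambda>q::real. (1 + q * q) / 2)"
  define Q where "Q n = (g ^^ n) 0" for n
  have Y0: "Y 0 = 0" and YS: "Y (Suc n) = (1/2) *\<^sub>R (x + Y n * Y n)" for n
    by (simp_all add: Y_def f_def)
  have Q0: "Q 0 = 0" and QS: "Q (Suc n) = (1 + Q n * Q n) / 2" for n
    by (simp_all add: Q_def g_def)
  have Qb: "0 \<le> Q n \<and> Q n \<le> 1" for n
  proof (induction n)
    case (Suc n)
    then have "Q n * Q n \<le> 1 * 1" by (intro mult_mono) auto
    then show ?case using Suc by (auto simp: QS)
  qed (simp add: Q0)
  have Qinc: "Q n \<le> Q (Suc n)" for n
    using zero_le_square[of "Q n - 1"] by (simp add: QS algebra_simps)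
  have com: "y * Y n = Y n * y" if "y * x = x * y" for y n
  proof (induction n)
    case (Suc n)
    have "y * (Y n * Y n) = (Y n * Y n) * y" using Suc by (metis mult.assoc)
    then show ?case using that by (simp add: YS algebra_simps)
  qed (simp add: Y0)
  have comY: "Y m * Y n = Y n * Y m" for m n
    using com com[OF refl] by metis
  have sa: "selfadj (Y n)" for n
    by (induction n) (simp_all add: Y0 YS selfadj_rules x)
  have nY: "norm (Y n) \<le> Q n" for n
  proof (induction n)
    case (Suc n)
    have "norm (Y n * Y n) \<le> Q n * Q n"
      using norm_mult_ineq[of "Y n" "Y n"] mult_mono[OF Suc Suc] Qb[of n] by auto
    then show ?case using norm_triangle_ineq[of x "Y n * Y n"] nx by (simp add: YS QS)
  qed (simp add: Y0 Q0)
  have step: "norm (Y (Suc n) - Y n) \<le> Q (Suc n) - Q n" for n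
  proof (induction n)
    case 0 show ?case using nx by (simp add: Y0 YS Q0 QS)
  next
    case (Suc n)
    have e: "Y (Suc (Suc n)) - Y (Suc n) = (1/2) *\<^sub>R ((Y (Suc n) - Y n) * (Y (Suc n) + Y n))"
      by (subst YS, subst (3) YS, simp add: algebra_simps comY[of n "Suc n"])
    have q: "Q (Suc (Suc n)) - Q (Suc n) = (Q (Suc n) - Q n) * (Q (Suc n) + Q n) / 2"
      unfolding QS[of "Suc n"] using QS[of n] by (simp add: field_simps)
    have "norm ((Y (Suc n) - Y n) * (Y (Suc n) + Y n)) \<le> (Q (Suc n) - Q n) * (Q (Suc n) + Q n)"
      using Suc norm_triangle_ineq[of "Y (Suc n)" "Y n"] nY[of n] nY[of "Suc n"] Qinc[of n]
      by (intro order.trans[OF norm_mult_ineq] mult_mono) auto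
    then show ?case by (simp only: e q) simp
  qed
  have dist: "norm (Y (n + k) - Y n) \<le> Q (n + k) - Q n" for n k
  proof (induction k)
    case (Suc k)
    then show ?case
      using norm_triangle_ineq[of "Y (Suc (n + k)) - Y (n + k)" "Y (n + k) - Y n"] step[of "n + k"]
      by simp
  qed simp
  have "incseq Q" by (rule incseq_SucI) (rule Qinc)
  then obtain L where "Q \<longlonglongrightarrow> L"
    using incseq_convergent[of Q 1] Qb by blast
  then have CQ: "Cauchy Q" by (rule LIMSEQ_imp_Cauchy)
  have "Cauchy Y"
  proof (rule CauchyI')
    fix e :: real assume "e > 0"
    then obtain M where M: "\<And>m n. m \<ge> M \<Longrightarrow> n \<ge> M \<Longrightarrow> norm (Q m - Q n) < e"
      using CauchyD[OF CQ] by blast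
    have "norm (Y m - Y n) < e" if "m \<ge> M" "n > m" for m n
      using dist[of m "n - m"] M[of n m] that by (simp add: norm_minus_commute)
    then show "\<exists>M. \<forall>m\<ge>M. \<forall>n>m. dist (Y m) (Y n) < e" unfolding dist_norm by blast
  qed
  then obtain y where y: "Y \<longlonglongrightarrow> y" using Cauchy_convergent convergent_def by blast
  have say: "selfadj y"
    using closed_sequentially[OF closed_selfadj _ y] sa by simp
  have ny: "norm y \<le> 1"
  proof (rule LIMSEQ_le_const2[OF tendsto_norm[OF y]])
    show "\<exists>N. \<forall>n\<ge>N. norm (Y n) \<le> 1" using nY Qb order.trans by blast
  qed
  have "(\<lambda>n. Y (Suc n)) \<longlonglongrightarrow> (1/2) *\<^sub>R (x + y * y)"
    unfolding YS by (intro tendsto_intros y)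
  then have yfix: "y = (1/2) *\<^sub>R (x + y * y)"
    using LIMSEQ_unique[OF LIMSEQ_Suc[OF y]] by blast
  have "2 *\<^sub>R y = x + y * y" using arg_cong[OF yfix, of "(*\<^sub>R) 2"] by simp
  then have sq: "(1 - y) * (1 - y) = 1 - x" by (simp add: algebra_simps scaleR_2) 
  have comy: "z * y = y * z" if "z * x = x * z" for z
  proof -
    have "(\<lambda>n. z * Y n) \<longlonglongrightarrow> z * y" "(\<lambda>n. Y n * z) \<longlonglongrightarrow> y * z"
      by (intro tendsto_intros y)+
    then show ?thesis using com[OF that] LIMSEQ_unique by auto
  qed
  have "selfadj (1 - y)" by (intro selfadj_rules say)
  moreover have "norm (1 - (1 - y)) \<le> 1" using ny by simp
  moreover have "z * (1 - y) = (1 - y) * z" if "z * x = x * z" for z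
    using comy[OF that] by (simp add: right_diff_distrib left_diff_distrib)
  ultimately show ?thesis using sq by blast
qed

text \<open>
  The norm condition places the spectrum of the self-adjoint element in the disc of radius \<open>t\<close> around
  \<open>t\<close>, which meets the real axis in \<open>[0, 2 t]\<close>. Asking for some \<open>t\<close> only makes closure under addition immediate.
\<close>

definition pos :: "'b \<Rightarrow> bool" where
  "pos a \<longleftrightarrow> selfadj a \<and> (\<exists>t\<ge>0. norm (t *\<^sub>R 1 - a) \<le> t)"

lemma pos_selfadj: "pos a \<Longrightarrow> selfadj a" by (simp add: pos_def)
lemma pos_mem: "pos a \<Longrightarrow> a \<in> A" by (simp add: pos_def selfadj_def)

lemma pos_add: assumes "pos a" "pos b" shows "pos (a + b)"
proof -
  obtain s t where "0 \<le> s" "norm (s *\<^sub>R 1 - a) \<le> s" "0 \<le> t" "norm (t *\<^sub>R 1 - b) \<le> t"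
    using assms by (auto simp: pos_def)
  moreover have eq: "(s + t) *\<^sub>R 1 - (a + b) = (s *\<^sub>R 1 - a) + (t *\<^sub>R 1 - b)" by (simp add: algebra_simps)
  ultimately have "norm ((s + t) *\<^sub>R 1 - (a + b)) \<le> s + t"
    unfolding eq by (intro norm_triangle_mono)
  then show ?thesis using assms \<open>0 \<le> s\<close> \<open>0 \<le> t\<close> unfolding pos_def by (intro conjI selfadj_add exI[of _ "s + t"]) auto
qed

lemma pos_scaleR: assumes "pos a" "0 \<le> r" shows "pos (r *\<^sub>R a)"
proof -
  obtain t where t: "0 \<le> t" "norm (t *\<^sub>R 1 - a) \<le> t" using assms by (auto simp: pos_def)
  have "(r * t) *\<^sub>R 1 - r *\<^sub>R a = r *\<^sub>R (t *\<^sub>R 1 - a)" by (simp add: algebra_simps)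
  then have "norm ((r * t) *\<^sub>R 1 - r *\<^sub>R a) \<le> r * t" using t assms(2) by (simp add: mult_left_mono)
  then show ?thesis using assms t unfolding pos_def by (intro conjI selfadj_scaleR exI[of _ "r * t"]) auto
qed

lemma pos_one: "pos 1"
  unfolding pos_def by (intro conjI selfadj_one exI[of _ 1]) auto

lemma pos_zero: "pos 0"
  using pos_scaleR[OF pos_one, of 0] by simp

lemma pos_scaleR_one_diff: assumes "selfadj a" "norm a \<le> t" shows "pos (t *\<^sub>R 1 - a)"
  unfolding pos_def using assms order.trans[OF norm_ge_zero assms(2)]
  by (intro conjI selfadj_rules exI[of _ t]) auto

lemma pos_sqrt:
  assumes "pos a"
  shows "\<exists>d. pos d \<and> d * d = a \<and> (\<forall>y. y * a = a * y \<longrightarrow> y * d = d * y)"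
proof -
  obtain t where t: "0 \<le> t" "norm (t *\<^sub>R 1 - a) \<le> t" and sa: "selfadj a" using assms by (auto simp: pos_def)
  show ?thesis
  proof (cases "t = 0")
    case True
    then have "a = 0" using t by simp
    then show ?thesis using pos_zero by (intro exI[of _ 0]) simp
  next
    case False
    then have t0: "t > 0" using t by simp
    define x where "x = 1 - (1/t) *\<^sub>R a"
    have "x = (1/t) *\<^sub>R (t *\<^sub>R 1 - a)" using t0 by (simp add: x_def algebra_simps)
    then have "norm x \<le> 1" using t t0 by (simp add: divide_simps)
    moreover have "selfadj x" unfolding x_def by (intro selfadj_rules sa)
    ultimately obtain d where d: "selfadj d" "norm (1 - d) \<le> 1" "d * d = 1 - x"
      and com: "\<And>y. y * x = x * y \<Longrightarrow> y * d = d * y"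
      using sqrt_one_minus[of x] by blast
    have "norm (1 *\<^sub>R 1 - d) \<le> 1" using d by simp
    then have "pos d" using d unfolding pos_def by (intro conjI exI[of _ 1]) auto
    then have "pos (sqrt t *\<^sub>R d)" using t by (intro pos_scaleR) auto
    moreover have "(sqrt t *\<^sub>R d) * (sqrt t *\<^sub>R d) = a" using t0 d by (simp add: x_def)
    moreover have "y * (sqrt t *\<^sub>R d) = (sqrt t *\<^sub>R d) * y" if "y * a = a * y" for y
      using com[of y] that by (simp add: x_def algebra_simps)
    ultimately show ?thesis by blast
  qed
qed

text \<open>
  The element \<open>U = F + iG\<close> satisfies \<open>U\<^sup>* U = t\<close>, and \<open>F\<close> is its real part.
\<close>

lemma norm_le_of_sum_squares:
  assumes F: "selfadj F" and G: "selfadj G" and com: "F * G = G * F"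
    and sum: "F * F + G * G = t *\<^sub>R 1" and t: "0 \<le> t"
  shows "norm (F * F) \<le> t"
proof -
  define U where "U = F + J * G"
  note m = selfadj_mem[OF F] selfadj_mem[OF G]
  have U: "U \<in> A" by (simp add: U_def m mem)
  have sU: "star U = F - J * G"
    using J_central[OF m(2)] by (simp add: U_def m mem star_rules selfadj_star[OF F] selfadj_star[OF G])
  have a: "J * G * F = F * (J * G)" 
    using J_central[OF m(1)] by (simp add: mult.assoc mult_left_cong[OF J_central[OF m(1)]] flip: com)
  have b: "J * G * (J * G) = - (G * G)"
    by (simp add: mult.assoc mult_left_cong[OF J_central[OF m(2), symmetric]] mult_left_cong[OF J_J])
  have "star U * U = (F - J * G) * (F + J * G)" unfolding sU by (simp add: U_def)
  also have "\<dots> = F * F + F * (J * G) - J * G * F - J * G * (J * G)" by (simp add: algebra_simps)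
  also have "\<dots> = t *\<^sub>R 1" unfolding a b using sum by simp
  finally have "star U * U = t *\<^sub>R 1" .
  then have nU: "(norm U)\<^sup>2 \<le> t" using cstar_identity[OF U] norm_scaleR_one_le[OF t] by simp
  have F2: "2 *\<^sub>R F = U + star U" unfolding sU by (simp add: U_def scaleR_2)
  have "2 * norm F = norm (U + star U)" by (simp flip: F2)
  then have "2 * norm F \<le> norm U + norm (star U)" using norm_triangle_ineq[of U "star U"] by simp
  then have "norm F \<le> norm U" using norm_star[OF U] by simp
  then have "(norm F)\<^sup>2 \<le> (norm U)\<^sup>2" by (intro power_mono) auto
  then show ?thesis using nU norm_selfadj_square[OF F] by linarith
qed

text \<open>
  After scaling, \<open>d\<close> plays the role of a cosine: \<open>1 - d\<^sup>2\<close> has a square root \<open>E\<close> because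
  \<open>1 - (1 - d\<^sup>2) = d\<^sup>2\<close> has norm at most 1, and this sine has norm at most 1 as well.
\<close>

lemma norm_diff_square_le:
  assumes d: "selfadj d" and r: "norm (d * d) \<le> r"
  shows "norm (r *\<^sub>R 1 - d * d) \<le> r"
proof -
  have r0: "0 \<le> r" using r norm_ge_zero order.trans by blast
  obtain E where E: "pos E" "E * E = r *\<^sub>R 1 - d * d"
    and com: "\<And>y. y * (r *\<^sub>R 1 - d * d) = (r *\<^sub>R 1 - d * d) * y \<Longrightarrow> y * E = E * y"
    using pos_sqrt[OF pos_scaleR_one_diff[OF selfadj_square[OF d] r]] by blast
  have "d * E = E * d" by (rule com) (simp add: algebra_simps)
  then show ?thesis
    using norm_le_of_sum_squares[OF pos_selfadj[OF E(1)] d _ _ r0] E by simp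
qed

lemma pos_square: "selfadj d \<Longrightarrow> pos (d * d)"
  unfolding pos_def using norm_diff_square_le[of d "norm (d * d)"]
  by (intro conjI selfadj_square exI[of _ "norm (d * d)"]) auto

text \<open>
  With \<open>t = \<parallel>q\<parallel>\<close> both \<open>p\<close> and \<open>t - p\<close> are squares, of commuting elements whose squares add up to \<open>t\<close>.
\<close>

lemma pos_mono_norm: assumes p: "pos p" and qp: "pos (q - p)" shows "norm p \<le> norm q"
proof -
  have q: "pos q" using pos_add[OF p qp] by simp
  have "pos (norm q *\<^sub>R 1 - q)" using pos_scaleR_one_diff[OF pos_selfadj[OF q]] by simp
  then have "pos (norm q *\<^sub>R 1 - p)" using pos_add[OF _ qp] by force
  then obtain G where G: "pos G" "G * G = norm q *\<^sub>R 1 - p"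
    and comG: "\<And>y. y * (norm q *\<^sub>R 1 - p) = (norm q *\<^sub>R 1 - p) * y \<Longrightarrow> y * G = G * y"
    using pos_sqrt by blast
  obtain F where F: "pos F" "F * F = p" using pos_sqrt[OF p] by blast
  have "F * p = p * F" by (simp add: mult.assoc flip: F(2))
  then have "F * G = G * F" by (intro comG) (simp add: algebra_simps)
  then show ?thesis using norm_le_of_sum_squares[OF pos_selfadj[OF F(1)] pos_selfadj[OF G(1)], of "norm q"] F G by simp
qed

lemma pos_antisym: "pos a \<Longrightarrow> pos (- a) \<Longrightarrow> a = 0"
  using pos_mono_norm[of a 0] by simp

text \<open>
  For \<open>w = e - d\<close> the elements \<open>w e w\<close> and \<open>w d w\<close> are positive with sum \<open>w (e\<^sup>2 - d\<^sup>2) = 0\<close>. So both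
  vanish, and so does their difference \<open>w\<^sup>3\<close>.
\<close>

lemma pos_sqrt_unique_commuting:
  assumes e: "pos e" and d: "pos d" and com: "e * d = d * e" and eq: "e * e = d * d"
  shows "e = d"
proof -
  define w where "w = e - d"
  note sa = pos_selfadj[OF e] pos_selfadj[OF d]
  have w: "selfadj w" unfolding w_def by (intro selfadj_rules sa)
  obtain F where F: "pos F" "F * F = e" and cF: "\<And>y. y * e = e * y \<Longrightarrow> y * F = F * y" using pos_sqrt[OF e] by blast
  obtain G where G: "pos G" "G * G = d" and cG: "\<And>y. y * d = d * y \<Longrightarrow> y * G = G * y" using pos_sqrt[OF d] by blast
  have wF: "w * F = F * w" by (rule cF) (simp add: w_def algebra_simps com)
  have wG: "w * G = G * w" by (rule cG) (simp add: w_def algebra_simps com)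
  have "pos (w * F * (w * F))" using selfadj_mult[OF w pos_selfadj[OF F(1)] wF] pos_square by blast
  moreover have "w * F * (w * F) = w * e * w" by (simp add: mult.assoc mult_left_cong[OF wF] wF flip: F(2))
  ultimately have p: "pos (w * e * w)" by simp
  have "pos (w * G * (w * G))" using selfadj_mult[OF w pos_selfadj[OF G(1)] wG] pos_square by blast
  moreover have "w * G * (w * G) = w * d * w" by (simp add: mult.assoc mult_left_cong[OF wG] wG flip: G(2))
  ultimately have q: "pos (w * d * w)" by simp
  have "(e + d) * w = 0" using com eq by (simp add: w_def algebra_simps)
  then have "w * ((e + d) * w) = 0" by simp
  then have "w * e * w + w * d * w = 0" by (simp only: distrib_left distrib_right mult.assoc)
  then have "w * d * w = - (w * e * w)" by (simp add: eq_neg_iff_add_eq_0 add.commute)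
  then have z: "w * e * w = 0" "w * d * w = 0" using pos_antisym[OF p] q by auto
  have "w * w * w = w * e * w - w * d * w" by (simp add: w_def algebra_simps)
  then have "w * w * w = 0" using z by simp
  then have "w * w * (w * w) = 0" by (simp flip: mult.assoc)
  then show ?thesis using selfadj_square_eq_0 w selfadj_square w_def by (metis eq_iff_diff_eq_0)
qed

text \<open>
  The root built by the iteration commutes with everything that commutes with its square, in
  particular with any other positive root.
\<close>

lemma pos_sqrt_unique:
  assumes e: "pos e" and d: "pos d" and eq: "e * e = d * d"
  shows "e = d"
proof -
  obtain f where f: "pos f" "f * f = d * d" and c: "\<And>y. y * (d * d) = d * d * y \<Longrightarrow> y * f = f * y"
    using pos_sqrt[OF pos_square[OF pos_selfadj[OF d]]] by blast
  have "d * f = f * d" by (rule c) (simp add: mult.assoc)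
  moreover have "e * f = f * e" by (rule c) (simp add: eq[symmetric] mult.assoc)
  ultimately show ?thesis
    using pos_sqrt_unique_commuting[OF e f(1)] pos_sqrt_unique_commuting[OF d f(1)] f eq by simp
qed

lemma pos_sqrt_commute:
  assumes "pos e" "y * (e * e) = e * e * y" shows "y * e = e * y"
  using pos_sqrt[OF pos_square[OF pos_selfadj[OF assms(1)]]] pos_sqrt_unique[OF assms(1)] assms by metis

lemma commuting_product_zero:
  assumes a: "selfadj a" and b: "selfadj b" and com: "a * b = b * a" and z: "(a * a) * (b * b) = 0"
  shows "a * b = 0"
proof (rule selfadj_square_eq_0)
  show "selfadj (a * b)" using a b com by (rule selfadj_mult)
  show "a * b * (a * b) = 0" 
    using z by (simp add: mult.assoc mult_left_cong[OF com[symmetric]])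
qed

text \<open>
  The candidates are \<open>p = (|a| + a) / 2\<close> and \<open>m = (|a| - a) / 2\<close>, with product 0. Their positivity is
  seen by comparison with \<open>q = |p|\<close> and \<open>n = |m|\<close>: also \<open>n q = 0\<close>, so \<open>n + q\<close> is a positive root of
  \<open>a\<^sup>2\<close> and hence equals \<open>p + m\<close>. Then \<open>n - m = p - q\<close> is orthogonal to itself.
\<close>

lemma pos_neg_parts:
  assumes a: "selfadj a"
  shows "\<exists>p m. pos p \<and> pos m \<and> a = p - m \<and> p * m = 0 \<and> m * p = 0"
proof -
  obtain e where e: "pos e" "e * e = a * a" and ce: "\<And>y. y * (a * a) = a * a * y \<Longrightarrow> y * e = e * y"
    using pos_sqrt[OF pos_square[OF a]] by blast
  have ae: "a * e = e * a" by (rule ce) (simp add: mult.assoc)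
  define m where "m = (1/2) *\<^sub>R (e - a)"
  define p where "p = (1/2) *\<^sub>R (e + a)"
  have sm: "selfadj m" and sp: "selfadj p" unfolding m_def p_def by (intro selfadj_rules a pos_selfadj[OF e(1)])+
  have pm: "p * m = 0" and mp: "m * p = 0" using e ae by (simp_all add: m_def p_def algebra_simps)
  have amp: "a = p - m" and emp: "e = p + m" unfolding m_def p_def
    by (simp_all add: scaleR_right_distrib[symmetric] scaleR_right_diff_distrib[symmetric] flip: scaleR_2)
  obtain n where n: "pos n" "n * n = m * m" and cn: "\<And>y. y * (m * m) = m * m * y \<Longrightarrow> y * n = n * y"
    using pos_sqrt[OF pos_square[OF sm]] by blast
  obtain q where q: "pos q" "q * q = p * p" and cq: "\<And>y. y * (p * p) = p * p * y \<Longrightarrow> y * q = q * y"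
    using pos_sqrt[OF pos_square[OF sp]] by blast
  note sn = pos_selfadj[OF n(1)] and sq = pos_selfadj[OF q(1)]
  have pmm: "p * (m * m) = m * m * p" "p * p * (m * m) = 0" "m * m * (p * p) = 0" "m * (p * p) = p * p * m"
    by (simp_all add: mult.assoc pm mp mult_left_cong[OF pm] mult_left_cong[OF mp])
  have cpn: "p * n = n * p" by (rule cn) (rule pmm)
  have cmq: "m * q = q * m" by (rule cq) (rule pmm)
  have cnq: "n * q = q * n" by (rule cq) (simp add: mult.assoc mult_left_cong[OF cpn[symmetric]] flip: cpn)
  have pn: "p * n = 0" by (rule commuting_product_zero) (use sp sn cpn n pmm in auto)
  have mq: "m * q = 0" by (rule commuting_product_zero) (use sm sq cmq q pmm in auto)
  have nq: "n * q = 0" by (rule commuting_product_zero) (use sn sq cnq q n pmm in auto)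
  have "n + q = e"
  proof (rule pos_sqrt_unique)
    show "pos (n + q)" by (rule pos_add) (use n q in auto)
    show "pos e" by (rule e)
    show "(n + q) * (n + q) = e * e" using nq cnq n q pm mp by (simp add: emp algebra_simps)
  qed
  then have nm: "n - m = p - q" by (simp add: emp algebra_simps)
  have "(n - m) * (n - m) = (n - m) * (p - q)" using nm by simp
  also have "\<dots> = 0" using nq mq pn cpn mp by (simp add: algebra_simps)
  finally have "n - m = 0" by (rule selfadj_square_eq_0[OF selfadj_diff[OF sn sm]])
  then have "n = m" "q = p" using nm by auto
  then show ?thesis using n q amp pm mp by blast
qed

lemma norm_power_two_pow: assumes "selfadj s" shows "norm (s ^ (2 ^ k)) = norm s ^ (2 ^ k) \<and> selfadj (s ^ (2 ^ k))"
proof (induction k)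
  case (Suc k)
  have "s ^ 2 ^ Suc k = s ^ (2 ^ k) * s ^ (2 ^ k)" by (simp add: mult_2 power_add)
  then show ?case using Suc norm_selfadj_square selfadj_square
    by (simp add: power_even_eq del: power_Suc) (simp add: power_even_eq)
qed (simp add: assms)

text \<open>
  A form of the fact that \<open>c\<^sup>* c\<close> and \<open>c c\<^sup>*\<close> have the same nonzero spectrum. For \<open>s = t + c c\<^sup>*\<close> one has
  \<open>s\<^sup>n = t\<^sup>n + c g c\<^sup>*\<close> with \<open>g\<close> a polynomial in \<open>c\<^sup>* c\<close>, and \<open>\<parallel>t + c\<^sup>* c\<parallel> \<le> t\<close> bounds \<open>\<parallel>g\<parallel>\<close> by \<open>n t\<^sup>n\<^sup>-\<^sup>1\<close>.
  So \<open>\<parallel>s\<^sup>n\<parallel> / t\<^sup>n\<close> grows at most linearly, whereas for the self-adjoint \<open>s\<close> it equals \<open>(\<parallel>s\<parallel> / t)\<^sup>n\<close>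
  along the powers of 2.
\<close>

lemma pos_uminus_swap:
  assumes c: "c \<in> A" and neg: "pos (- (star c * c))"
  shows "pos (- (c * star c))"
proof -
  obtain t where t: "0 \<le> t" "norm (t *\<^sub>R 1 + star c * c) \<le> t" using neg by (auto simp: pos_def)
  define s where "s = t *\<^sub>R 1 + c * star c"
  have ss: "selfadj s" "selfadj (c * star c)" using c by (simp_all add: s_def selfadj_def mem star_rules)
  show ?thesis
  proof (cases "t = 0")
    case True
    then have "c = 0" using t star_mult_self_eq_0[OF c] by simp
    then show ?thesis using pos_zero by (simp add: star_zero)
  next
    case False
    then have t0: "t > 0" using t by simp
    have pw: "\<exists>g. s ^ n = (t ^ n) *\<^sub>R 1 + c * g * star c \<and> norm g * t \<le> n * t ^ n" for n
    proof (induction n)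
      case 0 show ?case by (intro exI[of _ 0]) simp
    next
      case (Suc n)
      then obtain g where g: "s ^ n = (t ^ n) *\<^sub>R 1 + c * g * star c" "norm g * t \<le> n * t ^ n" by blast
      define h where "h = (t ^ n) *\<^sub>R 1 + g * (t *\<^sub>R 1 + star c * c)"
      have "s ^ Suc n = s ^ n * s" by (metis power_Suc2)
      also have "\<dots> = (t ^ Suc n) *\<^sub>R 1 + c * h * star c"
        unfolding g(1) unfolding h_def s_def by (simp add: algebra_simps)
      finally have 1: "s ^ Suc n = (t ^ Suc n) *\<^sub>R 1 + c * h * star c" .
      have "norm h \<le> norm ((t ^ n) *\<^sub>R (1::'b)) + norm (g * (t *\<^sub>R 1 + star c * c))"
        unfolding h_def by (rule norm_triangle_ineq)
      also have "\<dots> \<le> t ^ n + norm g * t"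
        using norm_scaleR_one_le[of "t ^ n"] t
        by (intro add_mono order.trans[OF norm_mult_ineq] mult_left_mono) auto
      also have "\<dots> \<le> t ^ n + n * t ^ n" using g by simp
      finally have "norm h \<le> Suc n * t ^ n" by (simp add: algebra_simps)
      then have "norm h * t \<le> Suc n * t ^ n * t" using t by (intro mult_right_mono) auto
      then have "norm h * t \<le> Suc n * t ^ Suc n" by (simp add: mult_ac)
      then show ?case using 1 by blast
    qed
    have bound: "norm (s ^ n) * t \<le> t ^ n * (t + n * (norm c)\<^sup>2)" for n
    proof -
      obtain g where g: "s ^ n = (t ^ n) *\<^sub>R 1 + c * g * star c" "norm g * t \<le> n * t ^ n" using pw by blast
      have "norm (s ^ n) \<le> norm ((t ^ n) *\<^sub>R (1::'b)) + norm (c * g * star c)"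
        unfolding g(1) by (rule norm_triangle_ineq)
      also have "\<dots> \<le> t ^ n + norm c * norm g * norm (star c)"
        using norm_scaleR_one_le[of "t ^ n"] t
        by (intro add_mono order.trans[OF norm_mult_ineq] mult_right_mono norm_mult_ineq) auto
      also have "\<dots> = t ^ n + (norm c)\<^sup>2 * norm g" by (simp add: norm_star[OF c] power2_eq_square)
      finally have "norm (s ^ n) * t \<le> (t ^ n + (norm c)\<^sup>2 * norm g) * t" using t by (intro mult_right_mono)
      also have "\<dots> = t ^ n * t + (norm c)\<^sup>2 * (norm g * t)" by (simp add: algebra_simps)
      also have "\<dots> \<le> t ^ n * t + (norm c)\<^sup>2 * (n * t ^ n)" using g by (intro add_left_mono mult_left_mono) auto
      finally show ?thesis by (simp add: algebra_simps)
    qed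
    have "norm s \<le> t"
    proof (rule ccontr)
      assume gt: "\<not> norm s \<le> t"
      define r where "r = norm s / t"
      have r: "r > 1" using gt t0 by (simp add: r_def)
      have b: "r ^ (2 ^ k) * t \<le> t + (2::real) ^ k * (norm c)\<^sup>2" for k
      proof -
        have "(norm s) ^ (2 ^ k) * t \<le> t ^ (2 ^ k) * (t + 2 ^ k * (norm c)\<^sup>2)"
          using bound[of "2 ^ k"] norm_power_two_pow[OF ss(1), of k] by simp
        then show ?thesis using t0 by (simp add: r_def power_divide divide_simps mult.commute)
      qed
      have "(\<lambda>n. (of_nat n) * (inverse r) ^ n) \<longlonglongrightarrow> 0"
        by (rule powser_times_n_limit_0) (use r in \<open>simp add: divide_simps\<close>)
      moreover have "(\<lambda>n. (inverse r) ^ n) \<longlonglongrightarrow> 0"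
        by (rule LIMSEQ_power_zero) (use r in \<open>simp add: divide_simps\<close>)
      ultimately have "(\<lambda>n. (inverse r) ^ n * t + (of_nat n * (inverse r) ^ n) * (norm c)\<^sup>2) \<longlonglongrightarrow> 0 * t + 0 * (norm c)\<^sup>2"
        by (intro tendsto_add tendsto_mult tendsto_const)
      then have "eventually (\<lambda>n. (inverse r) ^ n * t + (of_nat n * (inverse r) ^ n) * (norm c)\<^sup>2 < t) sequentially"
        using t0 order_tendstoD(2) by force
      then obtain N where N: "\<And>n. n \<ge> N \<Longrightarrow> (inverse r) ^ n * t + (of_nat n * (inverse r) ^ n) * (norm c)\<^sup>2 < t"
        by (auto simp: eventually_sequentially)
      have "(inverse r) ^ (2 ^ N) * t + (of_nat (2 ^ N) * (inverse r) ^ (2 ^ N)) * (norm c)\<^sup>2 < t"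
        by (rule N) (simp add: less_imp_le)
      then have "(t + 2 ^ N * (norm c)\<^sup>2) / r ^ (2 ^ N) < t"
        unfolding add_divide_distrib by (simp add: power_inverse divide_inverse mult_ac)
      then show False using b[of N] r by (simp add: divide_simps mult.commute[of t] split: if_splits)
    qed
    then have "norm (t *\<^sub>R 1 - (- (c * star c))) \<le> t" by (simp add: s_def)
    then show ?thesis using ss t unfolding pos_def by (intro conjI selfadj_minus exI[of _ t]) auto
  qed
qed

text \<open>
  If \<open>- b\<^sup>* b\<close> is positive, then so is \<open>- b b\<^sup>*\<close>; but \<open>b\<^sup>* b + b b\<^sup>*\<close> is a sum of squares of the real and
  imaginary part of \<open>b\<close>, so \<open>b = 0\<close>. This is applied to \<open>b = c m\<close> with \<open>m\<close> the negative part of \<open>c\<^sup>* c\<close>,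
  since \<open>b\<^sup>* b = - m\<^sup>3\<close>.
\<close>

lemma pos_star_mult: assumes c: "c \<in> A" shows "pos (star c * c)"
proof -
  have no_neg: "b = 0" if b: "b \<in> A" and n: "pos (- (star b * b))" for b
  proof -
    define h k where "h = b + star b" and "k = J * (b - star b)"
    have h: "selfadj h" using b by (simp add: h_def selfadj_def mem star_rules)
    have k: "selfadj k" using b J_central[OF diff_mem[OF b star_mem[OF b]]]
      by (simp add: k_def selfadj_def mem star_rules algebra_simps)
    have kk: "k * k = - ((b - star b) * (b - star b))"
      unfolding k_def
      by (simp add: mult.assoc mult_left_cong[OF J_central[OF diff_mem[OF b star_mem[OF b]], symmetric]] mult_left_cong[OF J_J])
    have "h * h + k * k = 2 *\<^sub>R (star b * b + b * star b)"
      unfolding kk h_def by (simp add: algebra_simps scaleR_2)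
    moreover have "pos (h * h + k * k)" by (intro pos_add pos_square h k)
    ultimately have "pos (2 *\<^sub>R (star b * b + b * star b))" by simp
    from pos_scaleR[OF this, of "1/2"] have "pos (star b * b + b * star b)" by simp
    then have "pos (star b * b)" using pos_add[OF _ pos_uminus_swap[OF b n]] by force
    then have "star b * b = 0" using pos_antisym n by blast
    then show ?thesis using star_mult_self_eq_0 b by blast
  qed
  obtain p m where pm: "pos p" "pos m" "star c * c = p - m" "p * m = 0" "m * p = 0"
    using pos_neg_parts[OF selfadj_star_mult[OF c]] by blast
  obtain f where f: "pos f" "f * f = m" using pos_sqrt[OF pm(2)] by blast
  have sm: "star m = m" using pos_selfadj[OF pm(2)] selfadj_star by blast
  have "star (c * m) * (c * m) = m * (star c * c) * m"
    using c pos_mem[OF pm(2)] sm by (simp add: mem star_rules mult.assoc)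
  also have "\<dots> = - (m * m * m)" unfolding pm(3) using pm(4,5) by (simp add: algebra_simps)
  finally have e: "star (c * m) * (c * m) = - (m * m * m)" .
  have fm: "m * f = f * m" by (simp add: mult.assoc flip: f(2))
  have "pos ((m * f) * (m * f))" by (intro pos_square selfadj_mult pos_selfadj pm f fm)
  moreover have "(m * f) * (m * f) = m * m * m" by (simp add: mult.assoc fm mult_left_cong[OF fm] mult_left_cong[OF f(2)])
  ultimately have "c * m = 0" using no_neg[of "c * m"] e c pos_mem[OF pm(2)] by (simp add: mem)
  then have "m * m * m = 0" using e by simp
  then have "(m * m) * (m * m) = 0" by (simp flip: mult.assoc)
  then have "m = 0" using selfadj_square_eq_0 selfadj_square pos_selfadj[OF pm(2)] by blast
  then show ?thesis using pm by simp
qed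

lemma pos_conj: assumes "pos a" "c \<in> A" shows "pos (star c * a * c)"
proof -
  obtain d where d: "pos d" "d * d = a" using pos_sqrt[OF assms(1)] by blast
  have "star (d * c) * (d * c) = star c * a * c"
    using d assms pos_mem[OF d(1)] selfadj_star[OF pos_selfadj[OF d(1)]]
    by (simp add: star_rules mult.assoc flip: d(2))
  then show ?thesis using pos_star_mult[of "d * c"] assms d pos_mem by (metis mult_mem)
qed

lemma neumann:
  assumes x: "x \<in> A" and n: "norm x < 1"
  shows "\<exists>R\<in>A. R * (1 - x) = 1 \<and> (1 - x) * R = 1"
proof -
  have le: "norm (x ^ k) \<le> norm x ^ k" for k
  proof (induction k)
    case (Suc k) then show ?case
      using norm_mult_ineq[of x "x ^ k"] mult_left_mono[of "norm (x ^ k)" "norm x ^ k" "norm x"] by simp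
  qed (simp add: norm_one_le)
  have s: "summable (\<lambda>k. x ^ k)"
    by (rule summable_comparison_test'[OF summable_geometric[of "norm x"]]) (use n le in auto)
  define R where "R = (\<Sum>k. x ^ k)"
  have pA: "x ^ k \<in> A" for k by (induction k) (simp_all add: mem x)
  have "(\<Sum>k<n. x ^ k) \<in> A" for n by (induction n) (simp_all add: mem pA)
  then have "R \<in> A"
    using closed_sequentially[OF closed_carrier _ summable_LIMSEQ[OF s]] by (simp add: R_def)
  have h: "R = 1 + (\<Sum>k. x ^ Suc k)" using suminf_split_head[OF s] by (simp add: R_def)
  have "x * R = (\<Sum>k. x ^ Suc k)" unfolding R_def by (simp add: suminf_mult[OF s])
  moreover have "R * x = (\<Sum>k. x ^ Suc k)" unfolding R_def
    using suminf_mult2[OF s, of x] by (simp add: power_commutes)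
  ultimately show ?thesis using h \<open>R \<in> A\<close> by (intro bexI[of _ R]) (simp_all add: algebra_simps)
qed

lemma pos_add_inverse:
  assumes a: "pos a" and l: "l > 0"
  shows "\<exists>R\<in>A. R * (l *\<^sub>R 1 + a) = 1 \<and> (l *\<^sub>R 1 + a) * R = 1"
proof -
  obtain t where t: "0 \<le> t" "norm (t *\<^sub>R 1 - a) \<le> t" using a by (auto simp: pos_def)
  define x where "x = (1 / (l + t)) *\<^sub>R (t *\<^sub>R 1 - a)"
  have x: "x \<in> A" unfolding x_def by (intro mem pos_mem a)
  have "norm x < 1" using t l by (simp add: x_def divide_simps)
  then obtain R where R: "R \<in> A" "R * (1 - x) = 1" "(1 - x) * R = 1" using neumann[OF x] by blast
  have lt: "l + t > 0" using t l by simp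
  have e: "l *\<^sub>R 1 + a = (l + t) *\<^sub>R (1 - x)" 
    using lt by (simp add: x_def right_diff_distrib scaleR_right_diff_distrib) (simp add: scaleR_left_distrib)
  show ?thesis unfolding e
    by (rule bexI[of _ "(1 / (l + t)) *\<^sub>R R"]) (use R lt in \<open>auto simp: mem\<close>)
qed

text \<open>
  The inverse \<open>R\<close> satisfies \<open>R \<le> n\<close> for some \<open>n\<close>; multiplying by the root of \<open>q\<close> from both sides gives
  \<open>1 \<le> n q\<close>.
\<close>

lemma pos_bounded_below:
  assumes q: "pos q" and R: "R \<in> A" "R * q = 1" "q * R = 1"
  shows "\<exists>\<epsilon>>0. pos (q - \<epsilon> *\<^sub>R 1)"
proof -
  obtain d where d: "pos d" "d * d = q" using pos_sqrt[OF q] by blast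
  have sd: "star d = d" "d \<in> A" using pos_selfadj[OF d(1)] pos_mem d by (auto simp: selfadj_def)
  have sq: "star q = q" "q \<in> A" using pos_selfadj[OF q] pos_mem q by (auto simp: selfadj_def)
  have "star R * q = 1" using R sq star_mult[of q R] star_one by simp
  then have "star R * q * R = R" by simp
  then have "star R = R" using R by (simp add: mult.assoc)
  then have sR: "selfadj R" using R by (simp add: selfadj_def)
  define n where "n = norm R + 1"
  have n: "n > 0" "norm R \<le> n" by (simp_all add: n_def add_nonneg_pos)
  have dq: "d * q = q * d" by (simp add: mult.assoc flip: d(2))
  have "R * (d * q) * R = R * (q * d) * R" using dq by simp
  then have dR: "d * R = R * d" using R by (simp add: mult.assoc mult_left_cong[OF R(2)])
  have "pos (star d * (n *\<^sub>R 1 - R) * d)" by (intro pos_conj pos_scaleR_one_diff sR n sd)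
  moreover have "star d * (n *\<^sub>R 1 - R) * d = n *\<^sub>R q - 1"
    using sd d dR R by (simp add: algebra_simps)
  ultimately have "pos ((1/n) *\<^sub>R (n *\<^sub>R q - 1))" using n by (intro pos_scaleR) auto
  then have "pos (q - (1/n) *\<^sub>R 1)" using n by (simp add: algebra_simps)
  then show ?thesis using n by (intro exI[of _ "1/n"]) simp
qed

text \<open>
  Let \<open>a = p - m\<close> and \<open>l = \<parallel>m\<parallel> > 0\<close>. Then \<open>l + a\<close> is positive and invertible, so \<open>l + a \<ge> \<epsilon>\<close>. Compression
  to \<open>m\<close> removes \<open>p\<close> and leaves \<open>m\<^sup>3 \<le> (l - \<epsilon>) m\<^sup>2\<close>, which contradicts \<open>\<parallel>m\<^sup>3\<parallel> = l\<^sup>3\<close>.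
\<close>

lemma pos_if_negative_resolvent:
  assumes a: "selfadj a"
    and inv: "\<And>l. l > 0 \<Longrightarrow> \<exists>R\<in>A. R * (l *\<^sub>R 1 + a) = 1 \<and> (l *\<^sub>R 1 + a) * R = 1"
  shows "pos a"
proof -
  obtain p m where pm: "pos p" "pos m" "a = p - m" "p * m = 0" "m * p = 0"
    using pos_neg_parts[OF a] by blast
  note sm = pos_selfadj[OF pm(2)]
  have "m = 0"
  proof (rule ccontr)
    assume "m \<noteq> 0"
    define l where "l = norm m"
    have l: "l > 0" using \<open>m \<noteq> 0\<close> by (simp add: l_def)
    have "pos (l *\<^sub>R 1 - m)" by (intro pos_scaleR_one_diff sm) (simp add: l_def)
    then have q: "pos (l *\<^sub>R 1 + a)" using pos_add[OF _ pm(1), of "l *\<^sub>R 1 - m"] unfolding pm(3) by (simp add: algebra_simps)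
    obtain \<epsilon> where e: "\<epsilon> > 0" "pos (l *\<^sub>R 1 + a - \<epsilon> *\<^sub>R 1)"
      using pos_bounded_below[OF q] inv[OF l] by blast
    have "pos (star m * (l *\<^sub>R 1 + a - \<epsilon> *\<^sub>R 1) * m)" using e pm pos_conj pos_mem by blast
    then have 1: "pos ((l - \<epsilon>) *\<^sub>R (m * m) - m * m * m)"
      using pm(4,5) selfadj_star[OF sm] by (simp add: pm(3) algebra_simps)
    obtain f where f: "pos f" "f * f = m" using pos_sqrt[OF pm(2)] by blast
    have fm: "m * f = f * m" by (simp add: mult.assoc flip: f(2))
    have "pos ((m * f) * (m * f))" by (intro pos_square selfadj_mult pos_selfadj pm f fm)
    moreover have "(m * f) * (m * f) = m * m * m" by (simp add: mult.assoc fm mult_left_cong[OF fm] mult_left_cong[OF f(2)])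
    ultimately have p3: "pos (m * m * m)" by simp
    have n3: "norm (m * m * m) = l ^ 3"
    proof -
      have "norm ((m * m) * (m * m)) = l ^ 4" using norm_selfadj_square[OF selfadj_square[OF sm]] norm_selfadj_square[OF sm] by (simp add: l_def flip: power_mult)
      then have "l ^ 4 \<le> norm (m * m * m) * l" using norm_mult_ineq[of "m * m * m" m] by (simp add: mult.assoc l_def)
      then have "l ^ 3 \<le> norm (m * m * m)" using l by (simp add: power_numeral_reduce)
      moreover have "norm (m * m * m) \<le> norm (m * m) * norm m" by (rule norm_mult_ineq)
      ultimately show ?thesis using norm_selfadj_square[OF sm] by (simp add: l_def power_numeral_reduce)
    qed
    have "l ^ 3 \<le> norm ((l - \<epsilon>) *\<^sub>R (m * m))" using pos_mono_norm[OF p3 1] n3 by simp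
    also have "\<dots> = \<bar>l - \<epsilon>\<bar> * l ^ 2" using norm_selfadj_square[OF sm] by (simp add: l_def)
    finally have "l \<le> \<bar>l - \<epsilon>\<bar>" using l by (simp add: power_numeral_reduce)
    then have "l < \<epsilon>" using e by auto
    then have "pos ((\<epsilon> - l) *\<^sub>R (m * m))" using pos_square[OF sm] by (intro pos_scaleR) auto
    from pos_add[OF 1 this] have "pos (- (m * m * m))" by (simp add: algebra_simps)
    then have "m * m * m = 0" using p3 pos_antisym by blast
    then show False using n3 l by simp
  qed
  then show ?thesis using pm by simp
qed

text \<open>
  For \<open>\<beta> \<noteq> 0\<close> and \<open>h = \<alpha> - a\<close> the product \<open>(h + i\<beta>) (h - i\<beta>) = \<beta>\<^sup>2 + h\<^sup>2\<close> is invertible, being a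
  positive element plus a positive number.
\<close>

lemma pos_resolvent:
  assumes a: "pos a" and z: "\<beta> \<noteq> 0 \<or> \<alpha> < 0"
  shows "\<exists>R\<in>A. R * (\<alpha> *\<^sub>R 1 + \<beta> *\<^sub>R J - a) = 1 \<and> (\<alpha> *\<^sub>R 1 + \<beta> *\<^sub>R J - a) * R = 1"
proof (cases "\<beta> = 0")
  case True
  then obtain R where R: "R \<in> A" "R * ((-\<alpha>) *\<^sub>R 1 + a) = 1" "((-\<alpha>) *\<^sub>R 1 + a) * R = 1"
    using pos_add_inverse[OF a, of "-\<alpha>"] z by auto
  then show ?thesis using True by (intro bexI[of _ "- R"]) (simp_all add: mem algebra_simps)
next
  case False
  define h where "h = \<alpha> *\<^sub>R 1 - a"
  have h: "selfadj h" unfolding h_def by (intro selfadj_rules pos_selfadj a)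
  have Jh: "J * h = h * J" using J_central selfadj_mem[OF h] by blast
  define u v where "u = h + \<beta> *\<^sub>R J" and "v = h - \<beta> *\<^sub>R J"
  have uv: "u * v = (\<beta> * \<beta>) *\<^sub>R 1 + h * h" "v * u = (\<beta> * \<beta>) *\<^sub>R 1 + h * h"
    using Jh J_J by (simp_all add: u_def v_def algebra_simps)
  obtain R where R: "R \<in> A" "R * ((\<beta> * \<beta>) *\<^sub>R 1 + h * h) = 1" "((\<beta> * \<beta>) *\<^sub>R 1 + h * h) * R = 1"
    using pos_add_inverse[OF pos_square[OF h], of "\<beta> * \<beta>"] False not_sum_squares_lt_zero[of \<beta> 0] by (metis mult_eq_0_iff not_real_square_gt_zero)
  have 1: "(R * v) * u = 1" "u * (v * R) = 1" using R uv by (simp_all add: mult.assoc flip: mult.assoc[of u])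
  have "(R * v) * (u * (v * R)) = R * v" using 1 by simp
  then have "R * v = v * R" using 1 by (simp flip: mult.assoc)
  moreover have "v * R \<in> A" by (simp add: v_def mem R selfadj_mem[OF h])
  moreover have "\<alpha> *\<^sub>R 1 + \<beta> *\<^sub>R J - a = u" by (simp add: u_def h_def)
  ultimately show ?thesis using 1 by (intro bexI[of _ "v * R"]) auto
qed

definition absolute :: "'b \<Rightarrow> 'b" where
  "absolute a = (THE d. pos d \<and> d * d = star a * a)"

lemma absolute_eqI: "pos d \<Longrightarrow> d * d = star a * a \<Longrightarrow> absolute a = d"
  unfolding absolute_def by (rule the_equality) (auto intro: pos_sqrt_unique)

lemma absolute: assumes "a \<in> A" shows "pos (absolute a)" "absolute a * absolute a = star a * a"
  using pos_sqrt[OF pos_star_mult[OF assms]] absolute_eqI by metis+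

definition projection :: "'b \<Rightarrow> bool" where
  "projection p \<longleftrightarrow> selfadj p \<and> p * p = p"

lemma projectionD: "projection p \<Longrightarrow> p \<in> A" "projection p \<Longrightarrow> star p = p" "projection p \<Longrightarrow> p * p = p"
  by (auto simp: projection_def selfadj_def)

lemma projection_mult:
  assumes "projection p" "projection q" "p * q = q * p"
  shows "projection (p * q)"
proof -
  have "p * q * (p * q) = p * (q * p) * q" by (simp only: mult.assoc)
  also have "\<dots> = p * (p * q) * q" by (simp only: assms(3))
  also have "\<dots> = (p * p) * (q * q)" by (simp only: mult.assoc)
  finally show ?thesis using assms by (simp add: projection_def selfadj_mult)
qed

lemma absorb_swap: "a \<in> A \<Longrightarrow> projection p \<Longrightarrow> a * p = a \<longleftrightarrow> p * star a = star a"
  by (metis projectionD(1,2) star_mult star_star mem(6))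

text \<open>
  \<open>\<parallel>c x\<parallel>\<^sup>2 = \<parallel>x\<^sup>* (c\<^sup>* c) x\<parallel>\<close> depends on \<open>c\<close> only through its Gram element.
\<close>

lemma cancel_gram:
  assumes "c \<in> A" "d \<in> A" "star c * c = star d * d" "d * x = 0" "x \<in> A" shows "c * x = 0"
proof (rule star_mult_self_eq_0)
  have "star (c * x) * (c * x) = star x * (star c * c) * x" using assms(1,5) by (simp add: star_mult mult.assoc)
  also have "\<dots> = star x * (star d * d) * x" by (simp only: assms(3))
  also have "\<dots> = star x * star d * (d * x)" by (simp only: mult.assoc)
  finally show "star (c * x) * (c * x) = 0" using assms(4) by simp
qed (use assms in \<open>simp add: mem\<close>)

lemma absolute_absorb:
  assumes a: "a \<in> A" and p: "projection p" and ap: "a * p = a"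
  shows "absolute a * p = absolute a" "p * absolute a = absolute a"
proof -
  note c = absolute[OF a] pos_selfadj[OF absolute(1)[OF a]]
  have "absolute a * (1 - p) = 0"
    by (rule cancel_gram[OF _ a])
      (use c a ap projectionD[OF p] in \<open>auto simp: selfadj_def mem right_diff_distrib\<close>)
  then show 1: "absolute a * p = absolute a" by (simp add: right_diff_distrib)
  show "p * absolute a = absolute a"
    using absorb_swap[OF selfadj_mem[OF c(3)] p] 1 selfadj_star[OF c(3)] by simp
qed

lemma partial_isometry_absorb:
  assumes u: "u \<in> A" and p: "projection (star u * u)"
  shows "u * (star u * u) = u"
proof -
  have "u * (1 - star u * u) = 0"
    by (rule cancel_gram[of _ "star u * u"])
      (use u projectionD[OF p] in \<open>auto simp: mem right_diff_distrib\<close>)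
  then show ?thesis by (simp add: right_diff_distrib)
qed

lemma final_projection:
  assumes u: "u \<in> A" and p: "projection (star u * u)"
  shows "projection (u * star u)"
  using partial_isometry_absorb[OF assms] u
  by (simp add: projection_def selfadj_def mem star_rules) (simp flip: mult.assoc)

end

section \<open>The Banach algebra of bounded endomorphisms\<close>

text \<open>
  A type of its own, so that composition becomes the multiplication of a ring and the simplifier's
  ring normalisation applies. The classes are chosen without \<open>0 \<noteq> 1\<close>, since the space may be trivial.
\<close>

typedef (overloaded) 'h op = "UNIV :: ('h::real_normed_vector \<Rightarrow>\<^sub>L 'h) set"
  morphisms blinfun_of_op op_of_blinfun ..

setup_lifting type_definition_op

lift_definition app :: "'h::real_normed_vector op \<Rightarrow> 'h \<Rightarrow> 'h" is blinfun_apply .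

instantiation op :: (real_normed_vector) real_normed_vector
begin

lift_definition zero_op :: "'a op" is 0 .
lift_definition plus_op :: "'a op \<Rightarrow> 'a op \<Rightarrow> 'a op" is "(+)" .
lift_definition minus_op :: "'a op \<Rightarrow> 'a op \<Rightarrow> 'a op" is "(-)" .
lift_definition uminus_op :: "'a op \<Rightarrow> 'a op" is "uminus" .
lift_definition scaleR_op :: "real \<Rightarrow> 'a op \<Rightarrow> 'a op" is "(*\<^sub>R)" .
lift_definition norm_op :: "'a op \<Rightarrow> real" is norm .

definition dist_op :: "'a op \<Rightarrow> 'a op \<Rightarrow> real" where "dist_op a b = norm (a - b)"
definition sgn_op :: "'a op \<Rightarrow> 'a op" where "sgn_op x = scaleR (inverse (norm x)) x"
definition uniformity_op :: "('a op \<times> 'a op) filter" where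
  "uniformity_op = (INF e\<in>{0 <..}. principal {(x, y). dist x y < e})"
definition open_op :: "'a op set \<Rightarrow> bool" where
  "open_op S = (\<forall>x\<in>S. \<forall>\<^sub>F (x', y) in uniformity. x' = x \<longrightarrow> y \<in> S)"

instance
  apply standard
  unfolding dist_op_def open_op_def sgn_op_def uniformity_op_def
  by (rule refl | (transfer, force simp: algebra_simps norm_triangle_ineq))+

end

instantiation op :: (real_normed_vector) "{real_normed_algebra, monoid_mult}"
begin

lift_definition times_op :: "'a op \<Rightarrow> 'a op \<Rightarrow> 'a op" is "(o\<^sub>L)" .
lift_definition one_op :: "'a op" is id_blinfun .

instance
  apply standard
  by (transfer, auto intro!: blinfun_eqI norm_blinfun_compose
      simp: blinfun.bilinear_simps)+

end

instance op :: (banach) banach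
proof
  fix X :: "nat \<Rightarrow> 'a op" assume X: "Cauchy X"
  have n: "norm (blinfun_of_op a - blinfun_of_op b) = norm (a - b)" for a b :: "'a op"
    by transfer simp
  have "Cauchy (\<lambda>n. blinfun_of_op (X n))"
    using X by (simp add: Cauchy_iff n)
  then obtain L where L: "(\<lambda>n. blinfun_of_op (X n)) \<longlonglongrightarrow> L"
    using Cauchy_convergent convergent_def by blast
  have "X \<longlonglongrightarrow> op_of_blinfun L"
    using L n[of _ "op_of_blinfun L"] by (simp add: LIMSEQ_iff op_of_blinfun_inverse)
  then show "convergent X" by (auto simp: convergent_def)
qed

lemma op_eqI: "(\<And>x. app a x = app b x) \<Longrightarrow> a = b"
  by transfer (rule blinfun_eqI)

lemma app_simps [simp]:
  "app 0 x = 0" "app 1 x = x" "app (a + b) x = app a x + app b x" "app (a - b) x = app a x - app b x"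
  "app (- a) x = - app a x" "app (r *\<^sub>R a) x = r *\<^sub>R app a x" "app (a * b) x = app a (app b x)"
  by (transfer, simp add: blinfun.bilinear_simps)+

lemma bounded_linear_app: "bounded_linear (app a)"
  by transfer (rule blinfun.bounded_linear_right)

lemma norm_app: "norm (app a x) \<le> norm a * norm x"
  by transfer (rule norm_blinfun)

lemma norm_op_le: "(\<And>x. norm (app a x) \<le> k * norm x) \<Longrightarrow> 0 \<le> k \<Longrightarrow> norm a \<le> k"
  by transfer (rule norm_blinfun_bound)

lemma bounded_linear_app_left: "bounded_linear (\<lambda>a. app a x)"
  by (rule bounded_linear_intro[of _ "norm x"]) (use norm_app in \<open>auto simp: mult.commute\<close>)

text \<open>
  A meaningful inverse of \<open>app\<close> on bounded linear maps only.
\<close>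

definition Op :: "('h::real_normed_vector \<Rightarrow> 'h) \<Rightarrow> 'h op" where
  "Op f = op_of_blinfun (Blinfun f)"

lemma app_Op: "bounded_linear f \<Longrightarrow> app (Op f) = f"
  by (simp add: Op_def app.rep_eq op_of_blinfun_inverse bounded_linear_Blinfun_apply)

lemma Op_app: "Op (app a) = a"
  by (rule op_eqI) (simp add: app_Op bounded_linear_app)

section \<open>Adjointable operators on a module with the Cauchy-Schwarz inequality\<close>

lemma scaleC_zero_right [simp]: "c *\<^sub>C (0::'a::complex_vector) = 0"
  using scaleC_add_right[of c 0 "0::'a"] by simp

lemma scaleC_minus_right: "c *\<^sub>C (- x) = - (c *\<^sub>C (x::'a::complex_vector))"
  using scaleC_add_right[of c x "- x"] by (simp add: eq_neg_iff_add_eq_0 add.commute)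

lemma scaleC_i_i: "\<i> *\<^sub>C \<i> *\<^sub>C x = - (x::'a::complex_vector)"
  using scaleC_of_real[of "-1" x] by (simp add: scaleC_scaleC)

lemma cstar_scaleR: "cstar (r *\<^sub>R a) = r *\<^sub>R cstar (a::'a::cstar_algebra)"
  using cstar_scaleC[of "complex_of_real r" a] by (simp add: scaleC_of_real)

lemma cstar_zero [simp]: "cstar (0::'a::cstar_algebra) = 0"
  using cstar_scaleR[of 0 0] by simp

lemma cstar_uminus: "cstar (- a) = - cstar (a::'a::cstar_algebra)"
  using cstar_scaleR[of "-1" a] by simp

lemma cstar_diff: "cstar (a - b) = cstar a - cstar (b::'a::cstar_algebra)"
  using cstar_add[of a "- b"] by (simp add: cstar_uminus)

lemma norm_cstar: "norm (cstar a) = norm (a::'a::cstar_algebra)"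
proof -
  have le: "norm b \<le> norm (cstar b)" for b :: 'a
  proof (cases "b = 0")
    case False
    have "norm b * norm b \<le> norm (cstar b) * norm b"
      using cstar_norm[of b] norm_mult_ineq[of "cstar b" b] by (simp add: power2_eq_square)
    then show ?thesis using False by simp
  qed simp
  show ?thesis using le[of a] le[of "cstar a"] by (simp add: cstar_cstar)
qed

text \<open>
  What the operator theory uses of a Hilbert module. There is no positivity of the inner product
  here; it is replaced by the Cauchy-Schwarz inequality, and both C*-algebras and Hilbert modules are
  instances.
\<close>

locale cauchy_schwarz_module =
  fixes ip :: "'h::{complex_vector, banach} \<Rightarrow> 'h \<Rightarrow> 'a::cstar_algebra"
  assumes ip_add_right: "ip x (y + z) = ip x y + ip x z"
    and ip_scaleC_right: "ip x (c *\<^sub>C y) = c *\<^sub>C ip x y"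
    and ip_cstar: "cstar (ip x y) = ip y x"
    and norm_ip_self: "norm (ip x x) = (norm x)\<^sup>2"
    and norm_ip_le: "norm (ip x y) \<le> norm x * norm y"
begin

lemma ip_add_left: "ip (x + y) z = ip x z + ip y z"
  by (metis ip_add_right ip_cstar cstar_add)

lemma ip_scaleC_left: "ip (c *\<^sub>C x) y = cnj c *\<^sub>C ip x y"
  by (metis ip_scaleC_right ip_cstar cstar_scaleC)

lemma ip_scaleR_right: "ip x (r *\<^sub>R y) = r *\<^sub>R ip x y"
  using ip_scaleC_right[of x "complex_of_real r" y] by (simp add: scaleC_of_real)

lemma ip_scaleR_left: "ip (r *\<^sub>R x) y = r *\<^sub>R ip x y"
  using ip_scaleC_left[of "complex_of_real r" x y] by (simp add: scaleC_of_real)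

lemma bounded_bilinear_ip: "bounded_bilinear ip"
  by standard (auto simp: ip_add_left ip_add_right ip_scaleR_left ip_scaleR_right intro!: exI[of _ 1] norm_ip_le)

sublocale ip: bounded_bilinear ip by (rule bounded_bilinear_ip)

lemma ip_eqI: assumes "\<And>y. ip y x = ip y x'" shows "x = x'"
proof -
  have "ip (x - x') (x - x') = 0" using assms by (simp add: ip.diff_right)
  then show ?thesis using norm_ip_self[of "x - x'"] by simp
qed

lemma ip_eqI_left: assumes "\<And>y. ip x y = ip x' y" shows "x = x'"
  by (rule ip_eqI) (metis assms ip_cstar)

lemma norm_scaleC_module: "norm (c *\<^sub>C x) = cmod c * norm (x::'h)"
proof -
  have "(norm (c *\<^sub>C x))\<^sup>2 = (cmod c * norm x)\<^sup>2"
    by (simp add: norm_ip_self[symmetric] ip_scaleC_left ip_scaleC_right norm_scaleC power_mult_distrib)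
       (simp add: power2_eq_square)
  then show ?thesis by (simp add: power2_eq_iff_nonneg)
qed

lemma adjI:
  assumes "\<And>x y. ip (B x) y = ip x (C y)"
  shows "adjointable ip B" "adj ip B = C"
proof -
  show "adjointable ip B" using assms by (auto simp: adjointable_def)
  show "adj ip B = C" unfolding adj_def
  proof (rule the_equality)
    fix C' assume "\<forall>x y. ip (B x) y = ip x (C' y)"
    then have "ip x (C' y) = ip x (C y)" for x y using assms by metis
    then show "C' = C" using ip_eqI by blast
  qed (use assms in simp)
qed

lemma ip_adj: assumes "adjointable ip B" shows "ip (B x) y = ip x (adj ip B y)"
proof -
  obtain C where C: "\<And>x y. ip (B x) y = ip x (C y)" using assms by (auto simp: adjointable_def)
  then show ?thesis using adjI(2)[OF C] by simp
qed

lemma ip_adj_left: "adjointable ip B \<Longrightarrow> ip (adj ip B x) y = ip x (B y)"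
  by (metis ip_adj ip_cstar)

lemma adjointable_adj: "adjointable ip B \<Longrightarrow> adjointable ip (adj ip B)"
  using adjI(1)[OF ip_adj_left] by blast

lemma adjointable_scaleC: "adjointable ip B \<Longrightarrow> B (c *\<^sub>C x) = c *\<^sub>C B x"
  by (rule ip_eqI_left) (simp add: ip_adj ip_scaleC_left)

text \<open>
  The sets \<open>E n = {x. \<parallel>B x\<parallel> \<le> n}\<close> are closed, because \<open>\<parallel>B x\<parallel>\<close> is the supremum of the continuous functions
  \<open>\<parallel>\<langle>x, B\<^sup>* y\<rangle>\<parallel>\<close> over the unit ball. By Baire's theorem one of them contains a ball.
\<close>

lemma adjointable_bounded_linear:
  assumes B: "adjointable ip B"
  shows "bounded_linear B"
proof -
  define C where "C = adj ip B"
  have C: "ip (B x) y = ip x (C y)" for x y using ip_adj[OF B] by (simp add: C_def)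
  have add: "B (x + y) = B x + B y" for x y
    by (rule ip_eqI_left) (simp add: C ip_add_left)
  have scale: "B (r *\<^sub>R x) = r *\<^sub>R B x" for r x
    by (rule ip_eqI_left) (simp add: C ip_scaleR_left)
  define E where "E n = {x. norm (B x) \<le> real n}" for n
  have E_eq: "E n = (\<Inter>y\<in>{y. norm y \<le> 1}. {x. norm (ip x (C y)) \<le> real n})" for n
  proof (intro set_eqI iffI)
    fix x assume x: "x \<in> E n"
    have "norm (ip (B x) y) \<le> n" if "norm y \<le> 1" for y
      using norm_ip_le[of "B x" y] mult_left_mono[OF that norm_ge_zero, of "B x"] x by (simp add: E_def)
    then show "x \<in> (\<Inter>y\<in>{y. norm y \<le> 1}. {x. norm (ip x (C y)) \<le> real n})" by (simp add: C)
  next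
    fix x assume "x \<in> (\<Inter>y\<in>{y. norm y \<le> 1}. {x. norm (ip x (C y)) \<le> real n})"
    then have b: "norm (ip (B x) y) \<le> n" if "norm y \<le> 1" for y using that by (simp add: C)
    have "norm (B x) \<le> n"
    proof (cases "B x = 0")
      case False
      have "norm (ip (B x) ((1 / norm (B x)) *\<^sub>R B x)) = norm (B x)"
        using False by (simp add: ip_scaleR_right norm_ip_self power2_eq_square)
      then show ?thesis using b[of "(1 / norm (B x)) *\<^sub>R B x"] False by simp
    qed simp
    then show "x \<in> E n" by (simp add: E_def)
  qed
  have clE: "closed (E n)" for n
    unfolding E_eq
    by (intro closed_INT ballI closed_Collect_le continuous_intros ip.continuous_on)
  have "\<exists>n. interior (E n) \<noteq> {}"
  proof (rule ccontr)
    assume "\<nexists>n. interior (E n) \<noteq> {}"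
    then have "euclidean interior_of \<Union>(range E) = {}"
      by (intro Baire_category_alt) (auto simp: completely_metrizable_space_euclidean clE)
    moreover have "\<Union>(range E) = UNIV"
      using real_arch_simple by (auto simp: E_def)
    ultimately show False by simp
  qed
  then obtain n x0 where "x0 \<in> interior (E n)" by blast
  then obtain r where r: "r > 0" "ball x0 r \<subseteq> E n" by (auto simp: mem_interior)
  have small: "norm (B h) \<le> 2 * n" if "norm h < r" for h
  proof -
    have "x0 \<in> E n" "x0 + h \<in> E n" using r that by (auto simp: dist_norm)
    moreover have "B h = B (x0 + h) - B x0" by (simp add: add)
    ultimately show ?thesis using norm_triangle_ineq4[of "B (x0 + h)" "B x0"] by (simp add: E_def)
  qed
  have "norm (B x) \<le> norm x * (4 * n / r)" for x
  proof (cases "x = 0")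
    case True then show ?thesis using scale[of 0 0] by simp
  next
    case False
    have "norm (B ((r / (2 * norm x)) *\<^sub>R x)) \<le> 2 * n" using r False by (intro small) simp
    then show ?thesis using r False by (simp add: scale field_simps)
  qed
  then show ?thesis by (rule bounded_linear_intro[OF add scale])
qed

definition adjs :: "'h op set" where "adjs = {a. adjointable ip (app a)}"

definition star :: "'h op \<Rightarrow> 'h op" where "star a = Op (adj ip (app a))"

definition J :: "'h op" where "J = Op (\<lambda>x. \<i> *\<^sub>C x)"

text \<open>
  Membership in \<open>adjs\<close> and the value of the star always come together from exhibiting an adjoint.
\<close>

lemma starI:
  assumes "\<And>x y. ip (app a x) y = ip x (app b y)"
  shows "a \<in> adjs" "star a = b"
  using adjI[of "app a" "app b", OF assms] by (simp_all add: adjs_def star_def Op_app)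

lemma app_star: "a \<in> adjs \<Longrightarrow> app (star a) = adj ip (app a)"
  by (simp add: adjs_def star_def app_Op adjointable_bounded_linear adjointable_adj)

lemma ip_star: "a \<in> adjs \<Longrightarrow> ip (app a x) y = ip x (app (star a) y)"
  using ip_adj by (simp add: adjs_def app_star)

lemma ip_star_left: "a \<in> adjs \<Longrightarrow> ip (app (star a) x) y = ip x (app a y)"
  using ip_adj_left by (simp add: adjs_def app_star)

lemma app_J: "app J x = \<i> *\<^sub>C x"
proof -
  have "bounded_linear (\<lambda>x::'h. \<i> *\<^sub>C x)"
    by (rule bounded_linear_intro[of _ 1])
      (auto simp: scaleC_add_right scaleC_scaleC norm_scaleC_module mult.commute simp flip: scaleC_of_real)
  then show ?thesis by (simp add: J_def app_Op)
qed

text \<open>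
  The half \<open>\<parallel>b x\<parallel>\<^sup>2 = \<parallel>\<langle>x, b\<^sup>* b x\<rangle>\<parallel> \<le> \<parallel>b\<^sup>* b\<parallel> \<parallel>x\<parallel>\<^sup>2\<close> of the C*-identity; this is where the constant 1 in the
  Cauchy-Schwarz inequality matters.
\<close>

lemma norm_square_le: assumes b: "b \<in> adjs" shows "(norm b)\<^sup>2 \<le> norm (star b * b)"
proof -
  have "norm b \<le> sqrt (norm (star b * b))"
  proof (rule norm_op_le)
    fix x
    have "(norm (app b x))\<^sup>2 = norm (ip x (app (star b * b) x))"
      by (simp add: norm_ip_self[symmetric] ip_star[OF b])
    also have "\<dots> \<le> norm x * (norm (star b * b) * norm x)"
      by (intro order.trans[OF norm_ip_le] mult_left_mono norm_app) auto
    also have "\<dots> = (sqrt (norm (star b * b)) * norm x)\<^sup>2"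
      by (simp add: power_mult_distrib) (simp add: power2_eq_square)
    finally show "norm (app b x) \<le> sqrt (norm (star b * b)) * norm x"
      by (rule power2_le_imp_le) simp
  qed simp
  then show ?thesis by (metis norm_ge_zero power_mono real_sqrt_pow2)
qed

lemma norm_star_adjs: assumes a: "a \<in> adjs" shows "norm (star a) = norm a"
proof -
  have le: "norm b \<le> norm (star b)" if b: "b \<in> adjs" for b
  proof (cases "b = 0")
    case False
    have "norm b * norm b \<le> norm (star b) * norm b"
      using norm_square_le[OF b] norm_mult_ineq[of "star b" b] by (simp add: power2_eq_square)
    then show ?thesis using False by simp
  qed simp
  have s: "star a \<in> adjs" "star (star a) = a" using starI[of "star a" a] ip_star_left[OF a] by auto
  show ?thesis using le[OF a] le[OF s(1)] s(2) by simp
qed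

lemma norm_star_mult_self: assumes a: "a \<in> adjs" shows "norm (star a * a) = (norm a)\<^sup>2"
  using norm_square_le[OF a] norm_mult_ineq[of "star a" a] norm_star_adjs[OF a]
  by (simp add: power2_eq_square)

text \<open>
  The star is isometric, so adjoints of a convergent sequence converge, to an adjoint of the limit.
\<close>

lemma closed_adjs: "closed adjs"
proof -
  have "l \<in> adjs" if X: "\<And>n. X n \<in> adjs" and lim: "X \<longlonglongrightarrow> l" for X l
  proof -
    have sd: "norm (star (X m) - star (X n)) = norm (X m - X n)" for m n
    proof -
      have "ip (app (X m - X n) x) y = ip x (app (star (X m) - star (X n)) y)" for x y
        by (simp add: ip.diff_left ip.diff_right ip_star X)
      from starI[OF this] show ?thesis using norm_star_adjs by metis
    qed
    have "Cauchy (\<lambda>n. star (X n))"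
      using LIMSEQ_imp_Cauchy[OF lim] by (simp add: Cauchy_iff sd)
    then obtain s where s: "(\<lambda>n. star (X n)) \<longlonglongrightarrow> s" using Cauchy_convergent convergent_def by blast
    have "ip (app l x) y = ip x (app s y)" for x y
    proof (rule LIMSEQ_unique)
      show "(\<lambda>n. ip (app (X n) x) y) \<longlonglongrightarrow> ip (app l x) y"
        by (intro ip.tendsto bounded_linear.tendsto[OF bounded_linear_app_left] lim tendsto_const)
      have "(\<lambda>n. ip x (app (star (X n)) y)) \<longlonglongrightarrow> ip x (app s y)"
        by (intro ip.tendsto bounded_linear.tendsto[OF bounded_linear_app_left] s tendsto_const)
      then show "(\<lambda>n. ip (app (X n) x) y) \<longlonglongrightarrow> ip x (app s y)" by (simp add: ip_star X)
    qed
    then show ?thesis by (rule starI)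
  qed
  then show ?thesis by (auto simp: closed_sequential_limits)
qed

sublocale star_algebra adjs star J
proof
  have ip_i: "ip (app J x) y = ip x (app (- J) y)" for x y
  proof -
    have "cnj \<i> *\<^sub>C ip x y + \<i> *\<^sub>C ip x y = 0 *\<^sub>C ip x y" by (simp flip: scaleC_add_left)
    also have "\<dots> = 0" using scaleC_of_real[of 0 "ip x y"] by simp
    finally show ?thesis
      by (simp add: app_J ip.minus_right ip_scaleC_left ip_scaleC_right eq_neg_iff_add_eq_0)
  qed
  show "J \<in> adjs" "star J = - J" using starI[OF ip_i] by auto
  show "J * J = - 1" by (rule op_eqI) (simp add: app_J scaleC_i_i)
  fix a b r
  show "1 \<in> adjs" by (rule starI(1)[of _ 1]) simp
  show "closed adjs" by (rule closed_adjs)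
  assume a: "a \<in> adjs"
  have sa: "ip (app (star a) x) y = ip x (app a y)" for x y by (rule ip_star_left[OF a])
  show "star a \<in> adjs" "star (star a) = a" using starI[OF sa] by auto
  have "ip (app (r *\<^sub>R a) x) y = ip x (app (r *\<^sub>R star a) y)" for x y
    by (simp add: ip_star a ip_scaleR_left ip_scaleR_right)
  then show "r *\<^sub>R a \<in> adjs" "star (r *\<^sub>R a) = r *\<^sub>R star a" by (rule starI)+
  show "norm (star a * a) = (norm a)\<^sup>2" by (rule norm_star_mult_self[OF a])
  show "J * a = a * J" using a by (intro op_eqI) (simp add: app_J adjs_def adjointable_scaleC)
  assume b: "b \<in> adjs"
  have "ip (app (a + b) x) y = ip x (app (star a + star b) y)" for x y
    by (simp add: ip_star a b ip_add_left ip_add_right)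
  then show "a + b \<in> adjs" "star (a + b) = star a + star b" by (rule starI)+
  have "ip (app (a * b) x) y = ip x (app (star b * star a) y)" for x y
    by (simp add: ip_star a b)
  then show "a * b \<in> adjs" "star (a * b) = star b * star a" by (rule starI)+
qed

lemma Op_adjs: "adjointable ip B \<Longrightarrow> Op B \<in> adjs \<and> app (Op B) = B"
  by (simp add: adjs_def app_Op adjointable_bounded_linear)

lemma comp_eq_op: "app a \<circ> app b = app c \<longleftrightarrow> a * b = c"
  by (metis op_eqI app_simps(7) comp_apply ext)

text \<open>
  From the left, only the resolvent at the negative real axis is used, and it yields positivity by
  norm; from the right, the norm criterion makes the resolvent exist off the closed half-axis.
\<close>

lemma op_positive_iff_pos: "op_positive ip (app a) \<longleftrightarrow> pos a"
proof
  assume p: "op_positive ip (app a)"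
  then have a: "a \<in> adjs" by (simp add: op_positive_def adjs_def)
  have "star a = a" using p by (metis op_positive_def star_def Op_app)
  then have sa: "selfadj a" using a by (simp add: selfadj_def)
  show "pos a"
  proof (rule pos_if_negative_resolvent[OF sa])
    fix l :: real assume l: "l > 0"
    have "- complex_of_real l \<notin> op_spectrum ip (app a)"
      using p l by (auto simp: op_positive_def subset_iff complex_nonneg_Reals_iff)
    then obtain R where R: "adjointable ip R" "R \<circ> (\<lambda>x. - complex_of_real l *\<^sub>C x - app a x) = id"
        "(\<lambda>x. - complex_of_real l *\<^sub>C x - app a x) \<circ> R = id"
      by (auto simp: op_spectrum_def)
    have e: "(\<lambda>x. - complex_of_real l *\<^sub>C x - app a x) = app (- (l *\<^sub>R 1 + a))"
      using scaleC_of_real[of "- l"] by (intro ext) simp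
    obtain r where r: "r \<in> adjs" "R = app r" using Op_adjs[OF R(1)] by metis
    have "r * (- (l *\<^sub>R 1 + a)) = 1" "- (l *\<^sub>R 1 + a) * r = 1"
      using R(2,3) unfolding e r(2) by (auto simp: fun_eq_iff intro!: op_eqI)
    moreover have "r * (- c) = 1 \<Longrightarrow> - c * r = 1 \<Longrightarrow> - r * c = 1 \<and> c * (- r) = 1" for c by simp
    ultimately have "- r * (l *\<^sub>R 1 + a) = 1 \<and> (l *\<^sub>R 1 + a) * (- r) = 1" by blast
    then show "\<exists>R\<in>adjs. R * (l *\<^sub>R 1 + a) = 1 \<and> (l *\<^sub>R 1 + a) * R = 1"
      using minus_mem[OF r(1)] by blast
  qed
next
  assume p: "pos a"
  then have sa: "a \<in> adjs" "star a = a" using pos_selfadj by (auto simp: selfadj_def)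
  have "z \<in> \<real>\<^sub>\<ge>\<^sub>0" if z: "z \<in> op_spectrum ip (app a)" for z
  proof (rule ccontr)
    assume "z \<notin> \<real>\<^sub>\<ge>\<^sub>0"
    then have "Im z \<noteq> 0 \<or> Re z < 0" by (auto simp: complex_nonneg_Reals_iff)
    then obtain r where r: "r \<in> adjs" "r * (Re z *\<^sub>R 1 + Im z *\<^sub>R J - a) = 1"
        "(Re z *\<^sub>R 1 + Im z *\<^sub>R J - a) * r = 1"
      using pos_resolvent[OF p] by blast
    have "z *\<^sub>C x = Re z *\<^sub>R x + Im z *\<^sub>R \<i> *\<^sub>C x" for x :: 'h
      by (subst complex_eq[of z])
        (simp add: scaleC_add_left scaleC_of_real mult.commute[of \<i>] flip: scaleC_scaleC)
    then have e: "(\<lambda>x. z *\<^sub>C x - app a x) = app (Re z *\<^sub>R 1 + Im z *\<^sub>R J - a)"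
      by (auto simp: app_J)
    have "app r \<circ> (\<lambda>x. z *\<^sub>C x - app a x) = id" "(\<lambda>x. z *\<^sub>C x - app a x) \<circ> app r = id"
      unfolding e using r(2,3)[THEN arg_cong[of _ _ app]] by (auto simp: fun_eq_iff)
    then show False using z r(1) by (auto simp: op_spectrum_def adjs_def)
  qed
  then show "op_positive ip (app a)"
    using sa app_star[OF sa(1)] by (auto simp: op_positive_def adjs_def)
qed

lemma op_abs_eq: assumes a: "a \<in> adjs" shows "op_abs ip (app a) = app (absolute a)"
  unfolding op_abs_def op_sqrt_def
proof (rule the_equality)
  have c: "adj ip (app a) \<circ> app a = app (star a * a)" by (auto simp: app_star[OF a])
  then show "op_positive ip (app (absolute a)) \<and> app (absolute a) \<circ> app (absolute a) = adj ip (app a) \<circ> app a"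
    using absolute[OF a] by (simp add: op_positive_iff_pos comp_eq_op)
  fix C assume C: "op_positive ip C \<and> C \<circ> C = adj ip (app a) \<circ> app a"
  then obtain d where d: "C = app d" using Op_adjs op_positive_def by metis
  then have "absolute a = d" using C by (intro absolute_eqI) (auto simp: op_positive_iff_pos comp_eq_op c)
  then show "C = app (absolute a)" using d by simp
qed

end

section \<open>The Cauchy-Schwarz inequality in Hilbert modules\<close>

text \<open>
  A C*-algebra as a module over itself: the Cauchy-Schwarz inequality is submultiplicativity of the
  norm.
\<close>

interpretation self: cauchy_schwarz_module "\<lambda>x y. cstar x * y :: 'a::cstar_algebra"
proof
  fix x y z :: 'a and c
  show "cstar x * (y + z) = cstar x * y + cstar x * z" by (rule distrib_left)
  show "cstar x * c *\<^sub>C y = c *\<^sub>C (cstar x * y)" by (rule scaleC_mult_right)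
  show "cstar (cstar x * y) = cstar y * x" by (simp add: cstar_mult cstar_cstar)
  show "norm (cstar x * x) = (norm x)\<^sup>2" by (rule cstar_norm)
  show "norm (cstar x * y) \<le> norm x * norm y" using norm_mult_ineq[of "cstar x" y] by (simp add: norm_cstar)
qed

definition left_mult :: "'a::cstar_algebra \<Rightarrow> 'a op" where
  "left_mult a = Op ((*) a)"

lemma app_left_mult: "app (left_mult a) x = a * x"
  by (simp add: left_mult_def app_Op bounded_linear_mult_right)

lemma left_mult_simps:
  "left_mult (a + b) = left_mult a + left_mult b" "left_mult (a - b) = left_mult a - left_mult b"
  "left_mult (r *\<^sub>R a) = r *\<^sub>R left_mult a" "left_mult (a * b) = left_mult a * left_mult b"
  by (rule op_eqI, simp add: app_left_mult algebra_simps)+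

lemma left_mult_star: "left_mult a \<in> self.adjs" "self.star (left_mult a) = left_mult (cstar a)"
proof -
  have "cstar (app (left_mult a) x) * y = cstar x * app (left_mult (cstar a)) y" for x y
    by (simp add: app_left_mult cstar_mult mult.assoc)
  then show "left_mult a \<in> self.adjs" "self.star (left_mult a) = left_mult (cstar a)" by (rule self.starI)+
qed

lemma norm_left_mult: "norm (left_mult a) = norm a"
proof (rule antisym)
  show "norm (left_mult a) \<le> norm a"
    by (rule norm_op_le) (simp_all add: app_left_mult norm_mult_ineq)
  show "norm a \<le> norm (left_mult a)"
  proof (cases "a = 0")
    case False
    have "norm a * norm a = norm (app (left_mult a) (cstar a))"
      using cstar_norm[of "cstar a"] by (simp add: app_left_mult cstar_cstar norm_cstar power2_eq_square)
    also have "\<dots> \<le> norm (left_mult a) * norm a" using norm_app[of "left_mult a" "cstar a"] by (simp add: norm_cstar)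
    finally show ?thesis using False by simp
  qed simp
qed

text \<open>
  An inverse \<open>(b, v)\<close> of \<open>z - a\<close> in the unitization acts on the algebra as \<open>x \<mapsto> b x + v x\<close>, and this is an
  adjointable inverse of \<open>z\<close> minus left multiplication by \<open>a\<close>. So passing to the left
  multiplication does not enlarge the spectrum.
\<close>

lemma pos_left_mult: assumes "cstar_positive a" shows "self.pos (left_mult a)"
proof -
  have sa: "cstar a = a" and sp: "cstar_spectrum a \<subseteq> \<real>\<^sub>\<ge>\<^sub>0" using assms by (auto simp: cstar_positive_def)
  have "op_spectrum (\<lambda>x y. cstar x * y) (app (left_mult a)) \<subseteq> cstar_spectrum a"
  proof (rule subsetI, rule ccontr)
    fix z assume z: "z \<in> op_spectrum (\<lambda>x y. cstar x * y) (app (left_mult a))" "z \<notin> cstar_spectrum a"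
    then obtain b v where q: "unitization_mult (- a, z) (b, v) = (0, 1)" "unitization_mult (b, v) (- a, z) = (0, 1)"
      by (auto simp: cstar_spectrum_def)
    define R where "R = (\<lambda>x. b * x + v *\<^sub>C x)"
    have m: "- x * y = - (x * y)" "v *\<^sub>C (- x) = - (v *\<^sub>C x)" for x y :: 'a
      by (simp_all add: scaleC_minus_right)
    have q1: "z *\<^sub>C b = a * b + v *\<^sub>C a" "z * v = 1" "z *\<^sub>C b = b * a + v *\<^sub>C a"
      using q by (auto simp: unitization_mult_def m algebra_simps eq_neg_iff_add_eq_0)
    have d: "v *\<^sub>C (x - y) = v *\<^sub>C x - v *\<^sub>C y" for x y :: 'a
      using scaleC_add_right[of v x "- y"] m(2)[of y] by simp
    have one: "1 *\<^sub>C x = x" for x :: 'a using scaleC_of_real[of 1 x] by simp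
    have "R (z *\<^sub>C x - a * x) = x" for x
    proof -
      have "R (z *\<^sub>C x - a * x) = (z *\<^sub>C b) * x - b * a * x + (z * v) *\<^sub>C x - (v *\<^sub>C a) * x"
        by (simp add: R_def d right_diff_distrib scaleC_mult_left scaleC_mult_right scaleC_scaleC mult.assoc mult.commute[of v z])
      then show ?thesis unfolding q1(3) q1(2) one by (simp add: algebra_simps)
    qed
    moreover have "z *\<^sub>C R x - a * R x = x" for x
    proof -
      have "z *\<^sub>C R x - a * R x = (z *\<^sub>C b) * x - a * b * x + (z * v) *\<^sub>C x - (v *\<^sub>C a) * x"
        by (simp add: R_def scaleC_add_right distrib_left scaleC_mult_left scaleC_mult_right scaleC_scaleC mult.assoc)
      then show ?thesis unfolding q1(1) q1(2) one by (simp add: algebra_simps)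
    qed
    moreover have "cstar (R x) * y = cstar x * (cstar b * y + cnj v *\<^sub>C y)" for x y
      by (simp add: R_def cstar_add cstar_mult cstar_scaleC distrib_left distrib_right
          scaleC_mult_left scaleC_mult_right mult.assoc)
    then have "adjointable (\<lambda>x y. cstar x * y) R" by (rule self.adjI)
    ultimately show False using z(1) by (auto simp: op_spectrum_def app_left_mult fun_eq_iff)
  qed
  then have "op_positive (\<lambda>x y. cstar x * y) (app (left_mult a))"
    using sp left_mult_star[of a] self.app_star[OF left_mult_star(1), of a] sa
    by (auto simp: op_positive_def self.adjs_def)
  then show ?thesis by (simp add: self.op_positive_iff_pos)
qed

context hilbert_module begin

text \<open>
  With \<open>a = \<langle>y, x\<rangle>\<close> and \<open>t = \<parallel>y\<parallel>\<^sup>2\<close>, expand \<open>\<langle>z, z\<rangle> \<ge> 0\<close> for \<open>z = x - y a / t\<close>. As \<open>\<langle>y, y\<rangle> \<le> t\<close>, it follows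
  that \<open>a\<^sup>* a / t \<le> \<langle>x, x\<rangle>\<close>, and norms are monotone on positive elements. The inequalities are read in
  the algebra of left multiplications.
\<close>

lemma norm_ip_le: "norm (ip x y) \<le> norm x * norm y"
proof -
  have sq: "(norm v)\<^sup>2 = norm (ip v v)" for v by (simp add: norm_eq_sqrt_ip)
  define t where "t = norm (ip y y)"
  define a where "a = ip y x"
  have a': "ip x y = cstar a" by (simp add: a_def ip_cstar)
  have sR: "ip u (r *\<^sub>R v) = r *\<^sub>R ip u v" for u v r
    using ip_scaleC_right[of u "complex_of_real r" v] by (simp add: scaleC_of_real)
  have zero: "ip u 0 = 0" for u using sR[of u 0 0] by simp
  have dR: "ip u (v - w) = ip u v - ip u w" for u v w
    using ip_add_right[of u v "- w"] sR[of u "-1" w] by simp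
  have dL: "ip (v - w) u = ip v u - ip w u" for u v w
    by (metis dR ip_cstar cstar_diff)
  have aL: "ip (act v b) u = cstar b * ip v u" for u v b
    by (metis ip_act_right ip_cstar cstar_mult)
  show ?thesis
  proof (cases "t = 0")
    case True
    then have "y = 0" using ip_definite by (simp add: t_def)
    then show ?thesis by (simp add: zero)
  next
    case False
    then have t: "t > 0" by (simp add: t_def less_le)
    let ?L = left_mult
    define z where "z = x - act y ((1/t) *\<^sub>R a)"
    have "ip z z = ip x x - (2/t) *\<^sub>R (cstar a * a) + (1/t\<^sup>2) *\<^sub>R (cstar a * ip y y * a)"
      by (simp add: z_def dR dL aL ip_act_right a' a_def[symmetric] cstar_scaleR algebra_simps power2_eq_square
          flip: scaleR_left_distrib)
    then have p1: "self.pos (?L (ip x x) - (2/t) *\<^sub>R ?L (cstar a * a) + (1/t\<^sup>2) *\<^sub>R ?L (cstar a * ip y y * a))"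
      using pos_left_mult[OF ip_positive[of z]] by (simp add: left_mult_simps)
    have y: "self.pos (?L (ip y y))" by (rule pos_left_mult[OF ip_positive])
    have "self.pos (t *\<^sub>R 1 - ?L (ip y y))"
      using self.pos_scaleR_one_diff[OF self.pos_selfadj[OF y]] by (simp add: norm_left_mult t_def)
    then have "self.pos (self.star (?L a) * (t *\<^sub>R 1 - ?L (ip y y)) * ?L a)"
      by (rule self.pos_conj) (rule left_mult_star)
    then have p2: "self.pos (t *\<^sub>R ?L (cstar a * a) - ?L (cstar a * ip y y * a))"
      by (simp add: left_mult_star left_mult_simps algebra_simps)
    have "self.pos ((1/t\<^sup>2) *\<^sub>R (t *\<^sub>R ?L (cstar a * a) - ?L (cstar a * ip y y * a)))"
      by (rule self.pos_scaleR[OF p2]) simp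
    moreover have "(1/t\<^sup>2) *\<^sub>R (t *\<^sub>R c - d) = (1/t) *\<^sub>R c - (1/t\<^sup>2) *\<^sub>R d" for c d :: "'a op"
      using t by (simp add: scaleR_right_diff_distrib power2_eq_square)
    ultimately have p3: "self.pos ((1/t) *\<^sub>R ?L (cstar a * a) - (1/t\<^sup>2) *\<^sub>R ?L (cstar a * ip y y * a))" by simp
    have eq: "b - (2/t) *\<^sub>R c + d + ((1/t) *\<^sub>R c - d) = b - (1/t) *\<^sub>R c" for b c d :: "'a op"
      using scaleR_left_distrib[of "1/t" "1/t" c] by simp
    have p4: "self.pos (?L (ip x x) - (1/t) *\<^sub>R ?L (cstar a * a))"
      using self.pos_add[OF p1 p3] unfolding eq .
    have "self.pos ((1/t) *\<^sub>R ?L (cstar a * a))"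
      using self.pos_scaleR[OF self.pos_star_mult[OF left_mult_star(1)[of a]], of "1/t"] t
      by (simp add: left_mult_star left_mult_simps)
    then have "norm ((1/t) *\<^sub>R ?L (cstar a * a)) \<le> norm (?L (ip x x))"
      using self.pos_mono_norm p4 by blast
    then have "(norm a)\<^sup>2 / t \<le> (norm x)\<^sup>2" using t by (simp add: norm_left_mult cstar_norm sq)
    then have "(norm a)\<^sup>2 \<le> (norm x * norm y)\<^sup>2"
      using t sq[of y] by (simp add: t_def divide_simps power_mult_distrib)
    then have "norm a \<le> norm x * norm y" by (rule power2_le_imp_le) simp
    then show ?thesis by (simp add: a' norm_cstar)
  qed
qed

sublocale cs: cauchy_schwarz_module ip
proof
  show "norm (ip x x) = (norm x)\<^sup>2" for x by (simp add: norm_eq_sqrt_ip)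
qed (rule ip_add_right ip_scaleC_right ip_cstar norm_ip_le)+

end

section \<open>Range projections and polar decompositions\<close>

context cauchy_schwarz_module begin

definition range_projection :: "'h op \<Rightarrow> 'h op \<Rightarrow> bool" where
  "range_projection a p \<longleftrightarrow> projection p \<and> closure (range (app a)) = range (app p)"

lemma range_projection_app: "projection p \<Longrightarrow> range (app p) = {x. app p x = x}"
  by (auto simp flip: app_simps(7) simp: projectionD(3)) (metis rangeI)

lemma closed_range_projection: assumes "projection p" shows "closed (range (app p))"
proof -
  have "closed {x. app p x = x}"
    using bounded_linear_app[of p] by (intro closed_Collect_eq linear_continuous_on continuous_on_id)
  then show ?thesis by (simp add: range_projection_app[OF assms])
qed

lemma range_projection_absorb: assumes "range_projection a p" shows "p * a = a"
proof (rule op_eqI)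
  fix x
  have "app a x \<in> range (app p)"
    using assms closure_subset[of "range (app a)"] by (auto simp: range_projection_def)
  then show "app (p * a) x = app a x"
    using assms by (simp add: range_projection_app range_projection_def)
qed

text \<open>
  Continuous maps preserve density of a range; this replaces the convergence arguments in all later
  computations of range projections.
\<close>

lemma range_mult_dense:
  assumes "range (app p) \<subseteq> closure (range (app a))"
  shows "range (app (l * p)) \<subseteq> closure (range (app (l * a)))"
proof -
  have "range (app (l * p)) = app l ` range (app p)" by auto
  also have "\<dots> \<subseteq> app l ` closure (range (app a))" using assms by blast
  also have "\<dots> \<subseteq> closure (app l ` range (app a))"
    by (intro closure_bounded_linear_image_subset bounded_linear_app)
  also have "app l ` range (app a) = range (app (l * a))" by auto
  finally show ?thesis .
qed

lemma range_mult_subset: "range (app (a * b)) \<subseteq> range (app a)"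
  by auto

lemma range_projection_annihilate:
  assumes a: "range_projection a p" and d: "d * a = 0"
  shows "d * p = 0"
proof -
  have "range (app (d * p)) \<subseteq> closure (range (app (d * a)))"
    using a by (intro range_mult_dense) (simp add: range_projection_def)
  then have "range (app (d * p)) \<subseteq> {0}" by (simp add: d)
  then show ?thesis by (intro op_eqI) auto
qed

lemma range_projectionI:
  assumes p: "projection p" and "p * a = a" "range (app p) \<subseteq> closure (range (app a))"
  shows "range_projection a p"
proof -
  have "range (app a) \<subseteq> range (app p)" using range_mult_subset[of p a] assms(2) by simp
  then have "closure (range (app a)) \<subseteq> range (app p)"
    by (rule closure_minimal) (rule closed_range_projection[OF p])
  then show ?thesis using assms by (auto simp: range_projection_def)
qed

text \<open>
  If \<open>e\<close> commutes with \<open>a\<close>, it leaves the range of \<open>a\<close> invariant, hence also the range of \<open>p\<close>. Applied to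
  \<open>d\<close> and to its adjoint, this makes the range of \<open>p\<close> reduce \<open>d\<close>.
\<close>

lemma range_projection_commute:
  assumes a: "range_projection a p" and d: "d \<in> adjs" "d * a = a * d" "star d * a = a * star d"
  shows "d * p = p * d"
proof -
  have p: "projection p" using a by (simp add: range_projection_def)
  note P = projectionD[OF p] and pa = range_projection_absorb[OF a]
  have inv: "p * e * p = e * p" if "e * a = a * e" for e
  proof -
    have "(1 - p) * e * a = 0"
      using that pa by (simp add: left_diff_distrib mult.assoc mult_left_cong[OF pa])
    from range_projection_annihilate[OF a this] show ?thesis by (simp add: left_diff_distrib mult.assoc)
  qed
  have "star (p * star d * p) = star (star d * p)" using inv[OF d(3)] by simp
  then have "p * d * p = p * d" using d(1) P by (simp add: mem star_rules mult.assoc)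
  then show ?thesis using inv[OF d(2)] by simp
qed

text \<open>
  The polar decomposition in terms of the algebra: the initial projection of \<open>u\<close> is the range
  projection of \<open>star b\<close>. That this range is orthogonally complemented is implied, being the range of
  a projection.
\<close>

definition polar :: "'h op \<Rightarrow> 'h op \<Rightarrow> bool" where
  "polar b u \<longleftrightarrow> u \<in> adjs \<and> b = u * absolute b \<and> range_projection (star b) (star u * u)"

context
  fixes b u assumes b: "b \<in> adjs" and bu: "polar b u"
begin

lemma polarD:
  shows "u \<in> adjs" "u * absolute b = b" "projection (star u * u)" "range_projection (star b) (star u * u)"
  using bu by (auto simp: polar_def range_projection_def)

lemma polar_initial: "u * (star u * u) = u"
  using partial_isometry_absorb polarD by blast

lemma polar_absolute:
  "pos (absolute b)" "absolute b \<in> adjs" "star (absolute b) = absolute b" "absolute b * absolute b = star b * b"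
  using absolute[OF b] pos_selfadj by (auto simp: selfadj_def)

lemma polar_absorb: "absolute b * (star u * u) = absolute b" "star u * u * absolute b = absolute b"
proof -
  have "b * (star u * u) = b"
    using absorb_swap[OF b polarD(3)] range_projection_absorb[OF polarD(4)] by simp
  from absolute_absorb[OF b polarD(3) this]
  show "absolute b * (star u * u) = absolute b" "star u * u * absolute b = absolute b" by auto
qed

lemma polar_range_projection_absolute: "range_projection (absolute b) (star u * u)"
proof (rule range_projectionI[OF polarD(3) polar_absorb(2)])
  have "star b = star (u * absolute b)" by (simp add: polarD(2))
  also have "\<dots> = absolute b * star u" by (simp add: star_mult polarD(1) polar_absolute(2,3))
  finally have "range (app (star b)) \<subseteq> range (app (absolute b))"
    using range_mult_subset by metis
  then show "range (app (star u * u)) \<subseteq> closure (range (app (absolute b)))"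
    using polarD(4) closure_mono[of "range (app (star b))" "range (app (absolute b))"]
    unfolding range_projection_def by argo
qed

text \<open>
  \<open>u |b| u\<^sup>*\<close> is positive, and its square is \<open>u |b|\<^sup>2 u\<^sup>* = b b\<^sup>*\<close>.
\<close>

lemma polar_absolute_star: "absolute (star b) = u * absolute b * star u"
proof (rule absolute_eqI)
  show "pos (u * absolute b * star u)"
    using pos_conj[OF polar_absolute(1), of "star u"] polarD(1) by (simp add: star_star star_mem)
  have "u * absolute b * star u * (u * absolute b * star u)
      = u * (absolute b * (star u * u) * absolute b) * star u" by (simp add: mult.assoc)
  also have "\<dots> = (u * absolute b) * star (u * absolute b)"
    unfolding polar_absorb star_mult[OF polarD(1) polar_absolute(2)] polar_absolute(3) by (simp only: mult.assoc)
  finally show "u * absolute b * star u * (u * absolute b * star u) = star (star b) * star b"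
    by (simp add: polarD(2) star_star b)
qed

lemma polar_right: "absolute (star b) * u = b"
proof -
  have "absolute (star b) * u = u * (absolute b * (star u * u))"
    unfolding polar_absolute_star by (simp only: mult.assoc)
  then show ?thesis by (simp only: polar_absorb polarD(2))
qed

lemma polar_range_projection_absolute_star: "range_projection (absolute (star b)) (u * star u)"
proof (rule range_projectionI)
  show "projection (u * star u)" by (rule final_projection[OF polarD(1,3)])
  show "u * star u * absolute (star b) = absolute (star b)"
    unfolding polar_absolute_star using polar_initial by (simp flip: mult.assoc)
  have "range (app (u * star u)) = range (app (u * (star u * u) * star u))"
    by (simp only: polar_initial)
  also have "\<dots> \<subseteq> range (app (u * (star u * u)))" by (rule range_mult_subset)
  also have "\<dots> \<subseteq> closure (range (app (u * absolute b)))"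
    using polar_range_projection_absolute by (intro range_mult_dense) (simp add: range_projection_def)
  also have "u * absolute b = absolute (star b) * u" by (simp add: polar_right polarD(2))
  also have "closure (range (app (absolute (star b) * u))) \<subseteq> closure (range (app (absolute (star b))))"
    by (rule closure_mono) (rule range_mult_subset)
  finally show "range (app (u * star u)) \<subseteq> closure (range (app (absolute (star b))))" .
qed

end

end

context hilbert_module begin

lemma range_proj_onto:
  assumes c: "orth_complemented act ip M"
  shows "range (proj_onto ip M) = M"
proof -
  have sm: "closed_submodule act M" and int: "M \<inter> orth_compl ip M = {0}"
    and ex: "\<And>x. \<exists>m\<in>M. \<exists>n\<in>orth_compl ip M. x = m + n"
    using c by (auto simp: orth_complemented_def)
  have diffM: "m - m' \<in> M" if "m \<in> M" "m' \<in> M" for m m'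
  proof -
    have "m + complex_of_real (-1) *\<^sub>C m' \<in> M" using sm that unfolding closed_submodule_def by blast
    then show ?thesis by (simp only: scaleC_of_real) simp
  qed
  have pr: "proj_onto ip M x = m" if m: "m \<in> M" "x - m \<in> orth_compl ip M" for x m
    unfolding proj_onto_def
  proof (rule the_equality)
    fix m' assume m': "m' \<in> M \<and> x - m' \<in> orth_compl ip M"
    have "m' - m = (x - m) - (x - m')" by simp
    also have "\<dots> \<in> orth_compl ip M" using m m' by (auto simp: orth_compl_def cs.ip.diff_left)
    finally have "m' - m \<in> M \<inter> orth_compl ip M" using diffM m m' by blast
    then show "m' = m" using int by simp
  qed (use m in simp)
  have z: "0 \<in> orth_compl ip M" by (simp add: orth_compl_def cs.ip.zero_left)
  show ?thesis
  proof (intro equalityI subsetI)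
    fix y assume "y \<in> range (proj_onto ip M)"
    then obtain x where x: "y = proj_onto ip M x" by blast
    obtain m n where mn: "m \<in> M" "n \<in> orth_compl ip M" "x = m + n" using ex by blast
    then show "y \<in> M" using pr[of m x] x by simp
  next
    fix y assume y: "y \<in> M"
    then have "proj_onto ip M y = y" using pr[of y y] z by simp
    then show "y \<in> range (proj_onto ip M)" by (metis rangeI)
  qed
qed

lemma app_act: "a \<in> cs.adjs \<Longrightarrow> app a (act x c) = act (app a x) c"
proof (rule cs.ip_eqI)
  fix y assume a: "a \<in> cs.adjs"
  show "ip y (app a (act x c)) = ip y (act (app a x) c)"
    by (simp add: cs.ip_star_left[OF a, symmetric] ip_act_right)
qed

lemma orth_complemented_range_projection:
  assumes p: "cs.projection p"
  shows "orth_complemented act ip (range (app p))" "proj_onto ip (range (app p)) = app p"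
proof -
  note P = cs.projectionD[OF p] and R = cs.range_projection_app[OF p]
  have sp: "ip (app p x) y = ip x (app p y)" for x y using cs.ip_star[OF P(1)] P(2) by simp
  have pp: "app p (app p x) = app p x" for x by (simp add: P(3) flip: app_simps(7))
  have orth: "x - app p x \<in> orth_compl ip (range (app p))" for x
    by (auto simp: orth_compl_def cs.ip.diff_left sp pp)
  have orth0: "app p x = 0" if "x \<in> orth_compl ip (range (app p))" for x
  proof (rule cs.ip_eqI_left)
    fix y show "ip (app p x) y = ip 0 y" using that by (simp add: sp orth_compl_def cs.ip.zero_left)
  qed
  show "orth_complemented act ip (range (app p))"
    unfolding orth_complemented_def closed_submodule_def
  proof (intro conjI)
    show "closed (range (app p))" by (rule cs.closed_range_projection[OF p])
    show "0 \<in> range (app p)" by (simp add: R cs.ip.zero_left linear_simps(3)[OF bounded_linear_app])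
    show "\<forall>x\<in>range (app p). \<forall>y\<in>range (app p). x + y \<in> range (app p)"
      by (simp add: R linear_simps(1)[OF bounded_linear_app])
    show "\<forall>c. \<forall>x\<in>range (app p). c *\<^sub>C x \<in> range (app p)"
      using P(1) by (simp add: R cs.adjs_def cs.adjointable_scaleC)
    show "\<forall>x\<in>range (app p). \<forall>a. act x a \<in> range (app p)"
      by (simp add: R app_act[OF P(1)])
    show "range (app p) \<inter> orth_compl ip (range (app p)) = {0}"
    proof (intro equalityI subsetI)
      fix x assume "x \<in> range (app p) \<inter> orth_compl ip (range (app p))"
      then show "x \<in> {0}" using orth0[of x] by (simp add: R)
    qed (simp add: R orth_compl_def cs.ip.zero_left linear_simps(3)[OF bounded_linear_app])
    show "\<forall>x. \<exists>m\<in>range (app p). \<exists>n\<in>orth_compl ip (range (app p)). x = m + n"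
    proof
      fix x show "\<exists>m\<in>range (app p). \<exists>n\<in>orth_compl ip (range (app p)). x = m + n"
        using orth[of x] by (intro bexI[of _ "app p x"] bexI[of _ "x - app p x"]) auto
    qed
  qed
  show "proj_onto ip (range (app p)) = app p"
  proof
    fix x show "proj_onto ip (range (app p)) x = app p x"
      unfolding proj_onto_def
    proof (rule the_equality)
      show "app p x \<in> range (app p) \<and> x - app p x \<in> orth_compl ip (range (app p))" using orth by simp
      fix m assume m: "m \<in> range (app p) \<and> x - m \<in> orth_compl ip (range (app p))"
      have "app p (x - m) = 0" using m orth0 by blast
      moreover have "app p m = m" using m unfolding R by blast
      ultimately show "m = app p x" by (simp add: linear_simps(2)[OF bounded_linear_app])
    qed
  qed
qed

lemma partial_isometry_iff:
  "partial_isometry ip (app u) \<longleftrightarrow> u \<in> cs.adjs \<and> cs.projection (cs.star u * u)"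
proof -
  have "is_projection ip (adj ip (app u) \<circ> app u) \<longleftrightarrow> cs.projection (cs.star u * u)" if u: "u \<in> cs.adjs"
  proof -
    have e: "adj ip (app u) \<circ> app u = app (cs.star u * u)" by (auto simp: cs.app_star[OF u])
    have m: "cs.star u * u \<in> cs.adjs" "cs.star (cs.star u * u) = cs.star u * u" using u by (simp_all add: cs.mem cs.star_rules)
    then have "adjointable ip (app (cs.star u * u))" by (simp add: cs.adjs_def)
    then show ?thesis unfolding e is_projection_def
      using cs.app_star[OF m(1)] m by (simp add: cs.projection_def cs.selfadj_def cs.comp_eq_op)
  qed
  then show ?thesis by (auto simp: partial_isometry_def cs.adjs_def)
qed

text \<open>
  A set with given orthogonal projection onto it is the range of this projection, and ranges of
  projections are complemented; so the two conditions on the closure of the range of the adjoint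
  amount to a single equation.
\<close>

lemma polar_decomposition_iff:
  assumes b: "b \<in> cs.adjs"
  shows "polar_decomposition act ip (app b) (app u) \<longleftrightarrow> cs.polar b u"
proof (cases "u \<in> cs.adjs \<and> cs.projection (cs.star u * u)")
  case False
  then show ?thesis
    by (auto simp: polar_decomposition_def partial_isometry_iff cs.polar_def cs.range_projection_def)
next
  case True
  have e: "adj ip (app u) \<circ> app u = app (cs.star u * u)" using cs.app_star True by auto
  have "app b = app u \<circ> op_abs ip (app b) \<longleftrightarrow> b = u * cs.absolute b"
    using cs.comp_eq_op[of u "cs.absolute b" b] by (auto simp: cs.op_abs_eq[OF b])
  moreover have "orth_complemented act ip M \<and> app (cs.star u * u) = proj_onto ip M \<longleftrightarrow> M = range (app (cs.star u * u))" for M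
    using orth_complemented_range_projection[of "cs.star u * u"] range_proj_onto[of M] True by metis
  ultimately show ?thesis
    using True unfolding polar_decomposition_def partial_isometry_iff cs.polar_def cs.range_projection_def e
      cs.app_star[OF b, symmetric] by blast
qed

end

section \<open>Products of three operators\<close>

locale commuting_polar_triple = cauchy_schwarz_module ip
  for ip :: "'h::{complex_vector, banach} \<Rightarrow> 'h \<Rightarrow> 'a::cstar_algebra" +
  fixes T A S U\<^sub>T U\<^sub>A U\<^sub>S :: "'h op"
  assumes mem_T: "T \<in> adjs" and mem_A: "A \<in> adjs" and mem_S: "S \<in> adjs"
    and polar_T: "polar T U\<^sub>T" and polar_A: "polar A U\<^sub>A" and polar_S: "polar S U\<^sub>S"
    and absolute_T_A: "absolute T * A = A * absolute T"
begin

abbreviation (input) "t \<equiv> absolute T"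
abbreviation (input) "a \<equiv> absolute A"
abbreviation (input) "s \<equiv> absolute (star S)"
definition "P\<^sub>T = star U\<^sub>T * U\<^sub>T"
definition "P\<^sub>A = star U\<^sub>A * U\<^sub>A"
definition "Q = U\<^sub>S * star U\<^sub>S"

definition E where "E = P\<^sub>T * P\<^sub>A"
definition X where "X = T * A * S"
definition Y where "Y = t * A * s"
definition Z where "Z = t * a * s"
definition V where "V = U\<^sub>T * U\<^sub>A * U\<^sub>S"
definition W where "W = P\<^sub>T * U\<^sub>A * Q"

lemmas U_mem = polarD(1)[OF mem_T polar_T] polarD(1)[OF mem_A polar_A] polarD(1)[OF mem_S polar_S]
lemmas initial_T = polarD(3)[OF mem_T polar_T, folded P\<^sub>T_def]
lemmas initial_A = polarD(3)[OF mem_A polar_A, folded P\<^sub>A_def]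
lemma final_S: "projection Q" unfolding Q_def by (rule final_projection[OF polarD(1,3)[OF mem_S polar_S]])
lemmas t_facts = polar_absolute(1-3)[OF mem_T polar_T]
lemmas a_facts = polar_absolute(1-3)[OF mem_A polar_A]
lemma s_facts: "pos s" "s \<in> adjs" "star s = s"
  using absolute[OF star_mem[OF mem_S]] pos_selfadj by (auto simp: selfadj_def)
lemmas range_t = polar_range_projection_absolute[OF mem_T polar_T, folded P\<^sub>T_def]
lemmas range_a = polar_range_projection_absolute[OF mem_A polar_A, folded P\<^sub>A_def]
lemmas range_s = polar_range_projection_absolute_star[OF mem_S polar_S, folded Q_def]
lemmas U\<^sub>T_P\<^sub>T = polar_initial[OF mem_T polar_T, folded P\<^sub>T_def]
lemmas U\<^sub>A_P\<^sub>A = polar_initial[OF mem_A polar_A, folded P\<^sub>A_def]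
lemma U\<^sub>S_star_U\<^sub>S_U\<^sub>S: "Q * U\<^sub>S = U\<^sub>S" "star U\<^sub>S * Q = star U\<^sub>S"
proof -
  show 1: "Q * U\<^sub>S = U\<^sub>S" using polar_initial[OF mem_S polar_S] by (simp add: Q_def mult.assoc)
  have "star (Q * U\<^sub>S) = star U\<^sub>S" by (simp only: 1)
  then show "star U\<^sub>S * Q = star U\<^sub>S"
    using projectionD[OF final_S] polarD(1)[OF mem_S polar_S] by (simp add: star_mult)
qed

lemmas membership = mem mem_T mem_A mem_S U_mem t_facts(2) a_facts(2) s_facts(2)
  projectionD(1)[OF initial_T] projectionD(1)[OF initial_A] projectionD(1)[OF final_S]

lemma t_star_A: "t * star A = star A * t"
proof -
  have "star (t * A) = star (A * t)" by (simp only: absolute_T_A)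
  then show ?thesis by (simp add: star_mult membership t_facts(3))
qed

lemma t_a: "t * a = a * t"
proof (rule pos_sqrt_commute[OF a_facts(1)])
  have "t * (star A * A) = star A * A * t"
    by (simp add: mult.assoc mult_left_cong[OF t_star_A] absolute_T_A)
  then show "t * (a * a) = a * a * t" using absolute(2)[OF mem_A] by simp
qed

lemma t_P\<^sub>A: "t * P\<^sub>A = P\<^sub>A * t"
  by (rule range_projection_commute[OF range_a]) (simp_all add: t_a t_facts)

text \<open>
  \<open>t U\<^sub>A\<close> and \<open>U\<^sub>A t\<close> agree after multiplication by \<open>a\<close>, that is, on the range of \<open>a\<close>, and hence on the
  initial space of \<open>U\<^sub>A\<close>; both vanish on its complement.
\<close>

lemma t_U\<^sub>A: "t * U\<^sub>A = U\<^sub>A * t"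
proof -
  have "t * (U\<^sub>A * a) = U\<^sub>A * a * t" using polarD(2)[OF mem_A polar_A] absolute_T_A by simp
  then have "(t * U\<^sub>A - U\<^sub>A * t) * a = 0" by (simp add: left_diff_distrib mult.assoc t_a)
  from range_projection_annihilate[OF range_a this]
  have "t * (U\<^sub>A * P\<^sub>A) = U\<^sub>A * (t * P\<^sub>A)" by (simp add: left_diff_distrib mult.assoc)
  also have "\<dots> = U\<^sub>A * P\<^sub>A * t" by (simp only: t_P\<^sub>A mult.assoc)
  finally show ?thesis by (simp only: U\<^sub>A_P\<^sub>A)
qed

lemma t_star_U\<^sub>A: "t * star U\<^sub>A = star U\<^sub>A * t"
proof -
  have "star (t * U\<^sub>A) = star (U\<^sub>A * t)" by (simp only: t_U\<^sub>A)
  then show ?thesis by (simp add: star_mult membership t_facts(3))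
qed

lemma P\<^sub>T_commute:
  "P\<^sub>T * U\<^sub>A = U\<^sub>A * P\<^sub>T" "P\<^sub>T * star U\<^sub>A = star U\<^sub>A * P\<^sub>T"
  using range_projection_commute[OF range_t, of U\<^sub>A] range_projection_commute[OF range_t, of "star U\<^sub>A"]
  by (simp_all add: membership star_star t_U\<^sub>A t_star_U\<^sub>A)

lemma P\<^sub>T_P\<^sub>A: "P\<^sub>T * P\<^sub>A = P\<^sub>A * P\<^sub>T"
proof -
  have "P\<^sub>T * P\<^sub>A = star U\<^sub>A * (P\<^sub>T * U\<^sub>A)" by (simp only: P\<^sub>A_def mult_left_cong[OF P\<^sub>T_commute(2)] mult.assoc)
  then show ?thesis by (simp only: P\<^sub>T_commute(1) P\<^sub>A_def mult.assoc)
qed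

lemma projection_E: "projection E"
  unfolding E_def by (rule projection_mult[OF initial_T initial_A P\<^sub>T_P\<^sub>A])

lemmas P\<^sub>T_t = polar_absorb(2)[OF mem_T polar_T, folded P\<^sub>T_def]
lemmas P\<^sub>A_a = polar_absorb(2)[OF mem_A polar_A, folded P\<^sub>A_def]

lemma E_ta: "E * (t * a) = t * a"
proof -
  have "E * (t * a) = P\<^sub>T * (P\<^sub>A * t) * a" by (simp only: E_def mult.assoc)
  also have "\<dots> = P\<^sub>T * t * (P\<^sub>A * a)" by (simp only: t_P\<^sub>A[symmetric] mult.assoc)
  finally show ?thesis by (simp only: P\<^sub>T_t P\<^sub>A_a)
qed

lemma P\<^sub>A_ta: "P\<^sub>A * (t * a) = t * a"
proof -
  have "P\<^sub>A * (t * a) = t * (P\<^sub>A * a)" by (simp only: mult.assoc[symmetric] t_P\<^sub>A[symmetric])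
  then show ?thesis by (simp only: P\<^sub>A_a)
qed

lemma s_Q: "s * Q = s"
  using absorb_swap[OF s_facts(2) final_S] range_projection_absorb[OF range_s] s_facts(3) by simp

lemma Z_mem: "Z \<in> adjs" and Y_mem: "Y \<in> adjs" and X_mem: "X \<in> adjs" and V_mem: "V \<in> adjs" and W_mem: "W \<in> adjs"
  by (simp_all add: Z_def Y_def X_def V_def W_def membership)

lemma U\<^sub>A_Z: "U\<^sub>A * Z = Y"
proof -
  have "U\<^sub>A * Z = t * (U\<^sub>A * a) * s" by (simp only: Z_def mult.assoc[symmetric] t_U\<^sub>A)
  then show ?thesis by (simp only: polarD(2)[OF mem_A polar_A] Y_def)
qed

lemma star_U\<^sub>A_Y: "star U\<^sub>A * Y = Z"
proof -
  have "star U\<^sub>A * Y = P\<^sub>A * (t * a) * s" by (simp only: U\<^sub>A_Z[symmetric] Z_def P\<^sub>A_def mult.assoc)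
  then show ?thesis by (simp only: P\<^sub>A_ta Z_def)
qed

lemma E_Z: "E * Z = Z"
proof -
  have "E * Z = E * (t * a) * s" by (simp only: Z_def mult.assoc)
  then show ?thesis by (simp only: E_ta Z_def)
qed

lemma Z_Q: "Z * Q = Z" and Y_Q: "Y * Q = Y"
  by (simp_all only: Z_def Y_def mult.assoc s_Q)

lemma P\<^sub>T_Y: "P\<^sub>T * Y = Y"
proof -
  have "P\<^sub>T * Y = P\<^sub>T * t * A * s" by (simp only: Y_def mult.assoc)
  then show ?thesis by (simp only: P\<^sub>T_t Y_def)
qed

text \<open>
  \<open>U\<^sub>A\<close> acts isometrically on the range of \<open>Z\<close>, which lies in its initial space.
\<close>

lemma gram_Z: "star Z * Z = star Y * Y"
proof -
  have "star Y * Y = star (U\<^sub>A * Z) * Y" by (simp only: U\<^sub>A_Z)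
  also have "\<dots> = star Z * (star U\<^sub>A * Y)" by (simp add: star_mult membership Z_mem mult.assoc)
  finally show ?thesis by (simp only: star_U\<^sub>A_Y)
qed

lemmas y_absorb = absolute_absorb[OF Y_mem final_S Y_Q]

lemma y_facts: "pos (absolute Y)" "absolute Y \<in> adjs" "star (absolute Y) = absolute Y"
  using absolute[OF Y_mem] pos_selfadj by (auto simp: selfadj_def)

lemma pos_Z_imp_absolute: assumes "pos Z" shows "absolute Y = Z"
  using assms gram_Z selfadj_star[OF pos_selfadj[OF assms]] by (intro absolute_eqI) auto

lemma W_absolute: "W * absolute Y = U\<^sub>A * (P\<^sub>T * absolute Y)"
proof -
  have "W * absolute Y = P\<^sub>T * U\<^sub>A * (Q * absolute Y)" by (simp only: W_def mult.assoc)
  also have "\<dots> = P\<^sub>T * U\<^sub>A * absolute Y" by (simp only: y_absorb)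
  finally show ?thesis by (simp only: P\<^sub>T_commute mult.assoc)
qed

text \<open>
  From left to right, \<open>Z = E |Y|\<close> has the same Gram element as \<open>|Y|\<close>. So the projection \<open>E\<close> does not
  shorten any vector in the range of \<open>|Y|\<close>, hence fixes all of them.
\<close>

lemma Y_eq_iff_pos: "Y = W * absolute Y \<longleftrightarrow> pos Z"
proof
  assume Y: "Y = W * absolute Y"
  have "Z = star U\<^sub>A * (U\<^sub>A * (P\<^sub>T * absolute Y))" using Y star_U\<^sub>A_Y W_absolute by simp
  also have "\<dots> = P\<^sub>A * P\<^sub>T * absolute Y" by (simp only: P\<^sub>A_def mult.assoc)
  also have "\<dots> = E * absolute Y" by (simp only: E_def P\<^sub>T_P\<^sub>A)
  finally have Z: "Z = E * absolute Y" .
  note E = projectionD[OF projection_E]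
  have EE: "E * (E * x) = E * x" for x by (simp only: mult.assoc[symmetric] E(3))
  have "star Z * Z = absolute Y * E * absolute Y"
    unfolding Z by (simp add: star_mult E y_facts mult.assoc EE)
  then have g: "absolute Y * E * absolute Y = absolute Y * absolute Y"
    using gram_Z absolute(2)[OF Y_mem] by simp
  have "(1 - E) * absolute Y = 0"
  proof (rule star_mult_self_eq_0)
    show "star ((1 - E) * absolute Y) * ((1 - E) * absolute Y) = 0"
      using g by (simp add: star_mult star_diff star_one membership E y_facts algebra_simps EE)
  qed (simp add: membership E y_facts)
  then have "E * absolute Y = absolute Y" by (simp add: left_diff_distrib)
  then show "pos Z" using Z y_facts by simp
next
  assume p: "pos Z"
  have "P\<^sub>T * Z = Z"
    by (simp only: Z_def mult_left_cong[OF P\<^sub>T_t] P\<^sub>T_t mult.assoc)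
  then show "Y = W * absolute Y"
    unfolding W_absolute[unfolded pos_Z_imp_absolute[OF p]] pos_Z_imp_absolute[OF p] by (simp only: U\<^sub>A_Z)
qed

lemma X_eq: "X = U\<^sub>T * Y * U\<^sub>S"
proof -
  have "U\<^sub>T * Y * U\<^sub>S = (U\<^sub>T * t) * A * (s * U\<^sub>S)" by (simp only: Y_def mult.assoc)
  also have "\<dots> = T * A * S" by (simp only: polarD(2)[OF mem_T polar_T] polar_right[OF mem_S polar_S])
  finally show ?thesis by (simp add: X_def)
qed

lemma absolute_X: "absolute X = star U\<^sub>S * absolute Y * U\<^sub>S"
proof (rule absolute_eqI)
  show "pos (star U\<^sub>S * absolute Y * U\<^sub>S)" by (rule pos_conj[OF y_facts(1) U_mem(3)])
  have "star U\<^sub>S * absolute Y * U\<^sub>S * (star U\<^sub>S * absolute Y * U\<^sub>S) = star U\<^sub>S * (absolute Y * (Q * absolute Y)) * U\<^sub>S"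
    by (simp only: Q_def mult.assoc)
  also have "\<dots> = star U\<^sub>S * (star Y * Y) * U\<^sub>S" by (simp only: y_absorb absolute(2)[OF Y_mem])
  also have "\<dots> = star U\<^sub>S * (star Y * (P\<^sub>T * Y)) * U\<^sub>S" by (simp only: P\<^sub>T_Y)
  also have "\<dots> = star X * X" by (simp add: X_eq star_mult membership Y_mem P\<^sub>T_def mult.assoc)
  finally show "star U\<^sub>S * absolute Y * U\<^sub>S * (star U\<^sub>S * absolute Y * U\<^sub>S) = star X * X" .
qed

text \<open>
  Multiplication by \<open>U\<^sub>T\<close> and \<open>U\<^sub>S\<close> is undone by their adjoints, since
  \<open>Y = P\<^sub>T Y Q\<close>, \<open>|Y| = Q |Y| Q\<close> and \<open>U\<^sub>T P\<^sub>T = U\<^sub>T\<close>.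
\<close>

lemma X_eq_iff_Y_eq: "X = V * absolute X \<longleftrightarrow> Y = W * absolute Y"
proof -
  have "V * absolute X = U\<^sub>T * U\<^sub>A * (Q * absolute Y) * U\<^sub>S" by (simp only: V_def absolute_X Q_def mult.assoc)
  also have "\<dots> = U\<^sub>T * (U\<^sub>A * absolute Y) * U\<^sub>S" by (simp only: y_absorb mult.assoc)
  finally have V: "V * absolute X = U\<^sub>T * (U\<^sub>A * absolute Y) * U\<^sub>S" .
  have W: "W * absolute Y = P\<^sub>T * (U\<^sub>A * absolute Y)"
    by (simp only: W_absolute mult_left_cong[OF P\<^sub>T_commute(1)] mult.assoc)
  show ?thesis
  proof
    assume "X = V * absolute X"
    then have "U\<^sub>T * Y * U\<^sub>S = U\<^sub>T * (U\<^sub>A * absolute Y) * U\<^sub>S" unfolding V using X_eq by simp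
    then have "star U\<^sub>T * (U\<^sub>T * Y * U\<^sub>S) * star U\<^sub>S = star U\<^sub>T * (U\<^sub>T * (U\<^sub>A * absolute Y) * U\<^sub>S) * star U\<^sub>S"
      by (rule arg_cong)
    then have "P\<^sub>T * (Y * Q) = P\<^sub>T * (U\<^sub>A * (absolute Y * Q))" by (simp only: P\<^sub>T_def Q_def mult.assoc)
    then show "Y = W * absolute Y" by (simp only: Y_Q P\<^sub>T_Y y_absorb W)
  next
    assume "Y = W * absolute Y"
    then have "X = U\<^sub>T * (P\<^sub>T * (U\<^sub>A * absolute Y)) * U\<^sub>S" using X_eq W by simp
    also have "\<dots> = U\<^sub>T * P\<^sub>T * (U\<^sub>A * absolute Y) * U\<^sub>S" by (simp only: mult.assoc)
    also have "\<dots> = V * absolute X" by (simp only: U\<^sub>T_P\<^sub>T V)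
    finally show "X = V * absolute X" .
  qed
qed

context
  assumes pos_Z: "pos Z"
begin

text \<open>
  A product of self-adjoint elements is self-adjoint only if they commute.
\<close>

lemma ta_s: "(t * a) * s = s * (t * a)"
proof -
  have "star (t * a * s) = t * a * s" using selfadj_star[OF pos_selfadj[OF pos_Z]] by (simp add: Z_def)
  then show ?thesis by (simp add: star_mult membership t_facts a_facts s_facts t_a mult.assoc)
qed

lemma star_ta: "star (t * a) = t * a"
  by (simp add: star_mult membership t_facts a_facts t_a)

text \<open>
  The range of \<open>a\<close> is dense in that of \<open>P\<^sub>A\<close> and the range of \<open>t\<close> in that of \<open>P\<^sub>T\<close>; the two steps are
  composed by moving \<open>P\<^sub>A\<close> past \<open>t\<close>.
\<close>

lemma range_ta: "range_projection (t * a) E"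
proof (rule range_projectionI[OF projection_E E_ta])
  have 1: "range (app (P\<^sub>A * P\<^sub>T)) \<subseteq> closure (range (app (P\<^sub>A * t)))"
    using range_t by (intro range_mult_dense) (simp add: range_projection_def)
  have 2: "range (app (t * P\<^sub>A)) \<subseteq> closure (range (app (t * a)))"
    using range_a by (intro range_mult_dense) (simp add: range_projection_def)
  have "closure (range (app (t * P\<^sub>A))) \<subseteq> closure (range (app (t * a)))"
    by (rule closure_minimal[OF 2 closed_closure])
  then show "range (app E) \<subseteq> closure (range (app (t * a)))"
    using 1 unfolding t_P\<^sub>A E_def P\<^sub>T_P\<^sub>A by (rule order.trans[rotated])
qed

lemma Q_ta: "(t * a) * Q = Q * (t * a)"
  by (rule range_projection_commute[OF range_s]) (simp_all add: membership star_ta ta_s)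

lemma Q_E: "Q * E = E * Q"
  by (rule range_projection_commute[OF range_ta]) (use projectionD[OF final_S] Q_ta in auto)

lemma projection_QE: "projection (Q * E)"
  by (rule projection_mult[OF final_S projection_E Q_E])

lemma star_Z: "star Z = Z"
  using selfadj_star[OF pos_selfadj[OF pos_Z]] .

lemma Q_Z: "Q * Z = Z"
  using absorb_swap[OF Z_mem final_S] Z_Q star_Z by simp

lemma Z_E: "Z * E = Z"
  using absorb_swap[OF Z_mem projection_E] E_Z star_Z by simp

lemma range_Z: "range_projection Z (Q * E)"
proof (rule range_projectionI[OF projection_QE])
  show "Q * E * Z = Z" by (simp only: mult.assoc E_Z Q_Z)
  have 1: "range (app (Q * E)) \<subseteq> closure (range (app (Q * (t * a))))"
    using range_ta by (intro range_mult_dense) (simp add: range_projection_def)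
  have 2: "range (app (t * a * Q)) \<subseteq> closure (range (app (t * a * s)))"
    using range_s by (intro range_mult_dense) (simp add: range_projection_def)
  have "closure (range (app (t * a * Q))) \<subseteq> closure (range (app (t * a * s)))"
    by (rule closure_minimal[OF 2 closed_closure])
  then show "range (app (Q * E)) \<subseteq> closure (range (app Z))"
    using 1 unfolding Q_ta Z_def by (rule order.trans[rotated])
qed

lemma gram_W: "star W * W = Q * E"
proof -
  note q = projectionD[OF final_S] and p = projectionD[OF initial_T]
  have "star W * W = Q * (star U\<^sub>A * (P\<^sub>T * P\<^sub>T) * U\<^sub>A) * Q"
    unfolding W_def by (simp add: star_mult membership q(1,2) p(1,2) mult.assoc)
  also have "star U\<^sub>A * (P\<^sub>T * P\<^sub>T) * U\<^sub>A = E"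
    unfolding p(3) E_def by (simp only: P\<^sub>A_def mult.assoc mult_left_cong[OF P\<^sub>T_commute(2)])
  also have "Q * E * Q = E * Q * Q" by (simp only: Q_E)
  finally show ?thesis by (simp only: mult.assoc q(3) Q_E)
qed

text \<open>
  \<open>Y\<^sup>* = Z U\<^sub>A\<^sup>*\<close> has the same range as \<open>Z\<close>, because \<open>Z = Z E\<close> is recovered from \<open>Y\<^sup>*\<close> by multiplication from the
  right.
\<close>

lemma polar_Y: "polar Y W"
  unfolding polar_def gram_W
proof (intro conjI W_mem)
  show "Y = W * absolute Y" using Y_eq_iff_pos pos_Z by simp
  have sY: "star Y = Z * star U\<^sub>A"
    using star_mult[OF U_mem(2) Z_mem] star_Z by (simp add: U\<^sub>A_Z)
  have "Z = Z * (P\<^sub>A * P\<^sub>T)" using Z_E by (simp only: E_def P\<^sub>T_P\<^sub>A)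
  then have "Z = star Y * (U\<^sub>A * P\<^sub>T)" by (simp only: sY P\<^sub>A_def mult.assoc)
  then have "range (app Z) \<subseteq> range (app (star Y))" using range_mult_subset by metis
  moreover have "range (app (star Y)) \<subseteq> range (app Z)" unfolding sY by (rule range_mult_subset)
  ultimately show "range_projection (star Y) (Q * E)" using range_Z by (simp add: range_projection_def)
qed

lemma gram_V: "star V * V = star U\<^sub>S * (Q * E) * U\<^sub>S"
proof -
  have "star V * V = star U\<^sub>S * (star U\<^sub>A * P\<^sub>T * U\<^sub>A) * U\<^sub>S"
    by (simp add: P\<^sub>T_def V_def star_mult membership mult.assoc)
  also have "star U\<^sub>A * P\<^sub>T * U\<^sub>A = E"
    by (simp only: E_def P\<^sub>A_def mult_left_cong[OF P\<^sub>T_commute(2)] mult.assoc)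
  finally show ?thesis by (simp only: mult_left_cong[OF U\<^sub>S_star_U\<^sub>S_U\<^sub>S(2)] mult.assoc)
qed

text \<open>
  \<open>X\<^sup>*\<close> has the same range as \<open>U\<^sub>S\<^sup>* Z\<close>, which is dense in the range of \<open>U\<^sub>S\<^sup>* Q E\<close>, and the latter contains the
  range of \<open>V\<^sup>* V = U\<^sub>S\<^sup>* (Q E) U\<^sub>S\<close>.
\<close>

lemma polar_X: "polar X V"
  unfolding polar_def
proof (intro conjI V_mem)
  show "X = V * absolute X" using X_eq_iff_Y_eq Y_eq_iff_pos pos_Z by simp
  note qe = projectionD[OF projection_QE]
  note gV = gram_V
  have QEQ: "Q * E * Q = Q * E"
    by (simp only: mult.assoc Q_E[symmetric] mult_left_cong[OF projectionD(3)[OF final_S]])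
  have sX: "star X = star U\<^sub>S * Z * star U\<^sub>A * star U\<^sub>T"
    using star_mult[OF U_mem(2) Z_mem]
    by (simp add: X_eq star_mult membership Y_mem star_Z U\<^sub>A_Z mult.assoc)
  show "range_projection (star X) (star V * V)"
  proof (rule range_projectionI)
    show "projection (star V * V)"
    proof -
      have "star V * V * (star V * V) = star U\<^sub>S * (Q * E * Q * (Q * E)) * U\<^sub>S"
        unfolding gV by (simp only: Q_def mult.assoc)
      also have "\<dots> = star U\<^sub>S * (Q * E) * U\<^sub>S" by (simp only: QEQ qe(3))
      finally have "star V * V * (star V * V) = star V * V" by (simp only: gV)
      then show ?thesis using selfadj_star_mult[OF V_mem] by (simp only: projection_def simp_thms)
    qed
    have "star V * V * star X = star U\<^sub>S * (Q * E * Q * Z) * star U\<^sub>A * star U\<^sub>T"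
      unfolding gV sX by (simp only: Q_def mult.assoc)
    then show "star V * V * star X = star X"
      unfolding sX by (simp only: QEQ) (simp only: mult.assoc E_Z Q_Z)
    have "star X * (U\<^sub>T * U\<^sub>A) = star U\<^sub>S * (Z * (star U\<^sub>A * P\<^sub>T * U\<^sub>A))" unfolding sX by (simp only: P\<^sub>T_def mult.assoc)
    also have "star U\<^sub>A * P\<^sub>T * U\<^sub>A = E"
      by (simp only: E_def P\<^sub>A_def mult_left_cong[OF P\<^sub>T_commute(2)] mult.assoc)
    finally have "star X * (U\<^sub>T * U\<^sub>A) = star U\<^sub>S * Z" by (simp only: Z_E)
    then have "range (app (star U\<^sub>S * Z)) \<subseteq> range (app (star X))" by (metis range_mult_subset)
    then have 1: "closure (range (app (star U\<^sub>S * Z))) \<subseteq> closure (range (app (star X)))" by (rule closure_mono)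
    have "range (app (star V * V)) \<subseteq> range (app (star U\<^sub>S * (Q * E)))"
      unfolding gV by (rule range_mult_subset)
    also have "\<dots> \<subseteq> closure (range (app (star U\<^sub>S * Z)))"
      using range_Z by (intro range_mult_dense) (simp add: range_projection_def)
    finally show "range (app (star V * V)) \<subseteq> closure (range (app (star X)))" using 1 by blast
  qed
qed

end

lemma polar_equivalences:
  "polar X V \<longleftrightarrow> pos Z" "polar Y W \<longleftrightarrow> pos Z" "X = V * absolute X \<longleftrightarrow> pos Z" "Y = W * absolute Y \<longleftrightarrow> pos Z"
  using polar_X polar_Y X_eq_iff_Y_eq Y_eq_iff_pos by (auto simp: polar_def)

end

section \<open>The equivalence\<close>

theorem theorem4p8:
  fixes act :: "'h::{complex_vector, banach} \<Rightarrow> 'a::cstar_algebra \<Rightarrow> 'h"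
    and ip :: "'h \<Rightarrow> 'h \<Rightarrow> 'a"
    and T A S U_T U_A U_S X Y W :: "'h \<Rightarrow> 'h"
  assumes "hilbert_module act ip"
    and "adjointable ip T" and "adjointable ip A" and "adjointable ip S"
    and "polar_decomposition act ip T U_T"
    and "polar_decomposition act ip A U_A"
    and "polar_decomposition act ip S U_S"
    and "commutator (op_abs ip T) A = (\<lambda>x. 0)"
    and "X = T \<circ> A \<circ> S"
    and "Y = op_abs ip T \<circ> A \<circ> op_abs ip (adj ip S)"
    and "W = adj ip U_T \<circ> U_T \<circ> U_A \<circ> U_S \<circ> adj ip U_S"
  shows "(polar_decomposition act ip X (U_T \<circ> U_A \<circ> U_S) \<longleftrightarrow> polar_decomposition act ip Y W) \<and>
    (polar_decomposition act ip Y W \<longleftrightarrow> X = U_T \<circ> U_A \<circ> U_S \<circ> op_abs ip X) \<and>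
    (X = U_T \<circ> U_A \<circ> U_S \<circ> op_abs ip X \<longleftrightarrow> Y = W \<circ> op_abs ip Y) \<and>
    (Y = W \<circ> op_abs ip Y \<longleftrightarrow>
       op_positive ip (op_abs ip T \<circ> op_abs ip A \<circ> op_abs ip (adj ip S)))"
proof -
  interpret hilbert_module act ip by fact
  have "adjointable ip U_T" "adjointable ip U_A" "adjointable ip U_S"
    using assms(5-7) by (auto simp: polar_decomposition_def partial_isometry_def)
  then obtain t a s ut ua us where ops: "T = app t" "A = app a" "S = app s"
      "U_T = app ut" "U_A = app ua" "U_S = app us"
      and mem: "t \<in> cs.adjs" "a \<in> cs.adjs" "s \<in> cs.adjs" "ut \<in> cs.adjs" "ua \<in> cs.adjs" "us \<in> cs.adjs"
    using cs.Op_adjs assms(2-4) by metis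
  note abs = cs.op_abs_eq[OF mem(1)] cs.op_abs_eq[OF mem(2)]
    cs.op_abs_eq[OF cs.star_mem[OF mem(3)], unfolded cs.app_star[OF mem(3)]]
  have "cs.absolute t * a = a * cs.absolute t"
    by (rule op_eqI) (use assms(8) in \<open>simp add: commutator_def ops abs fun_eq_iff\<close>)
  moreover have "cs.polar t ut" "cs.polar a ua" "cs.polar s us"
    using assms(5-7) mem by (simp_all add: ops polar_decomposition_iff)
  ultimately interpret cp: commuting_polar_triple ip t a s ut ua us
    by unfold_locales (use mem in auto)
  have comp: "app b \<circ> app c = app (b * c)" for b c :: "'h op" by auto
  have X: "X = app cp.X" and Y: "Y = app cp.Y" and W: "W = app cp.W"
    and V: "U_T \<circ> U_A \<circ> U_S = app cp.V"
    and Z: "op_abs ip T \<circ> op_abs ip A \<circ> op_abs ip (adj ip S) = app cp.Z"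
    by (simp_all add: assms(9-11) ops abs comp cp.X_def cp.Y_def cp.Z_def cp.W_def cp.V_def cp.P\<^sub>T_def cp.Q_def mult.assoc
        flip: cs.app_star[OF mem(4)] cs.app_star[OF mem(6)])
  have eq: "app b = app c \<longleftrightarrow> b = c" for b c :: "'h op" by (metis Op_app)
  show ?thesis
    unfolding V Z unfolding X Y W
    by (simp add: polar_decomposition_iff cp.X_mem cp.Y_mem cs.op_abs_eq comp eq cs.op_positive_iff_pos
        cp.polar_equivalences)
qed

end
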